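(* Let $d\ge 1$, $\boldsymbol r\in\mathbb N^d$, $\boldsymbol\sigma=(\sigma_1,\dots,\sigma_d)\in\prod_{l=1}^d(0,r_l+1)$, $0<p<\infty$ and $1\le q\le\infty$ be such that $H(\boldsymbol\sigma)/d>(1/p-1/q)_+$, and let $p'=\infty$ if $0<p\le1$ or $p\ge q$, and $p'=p$ if $1<p<q$. There exist positive reals $C_1(d,\boldsymbol\sigma,p)$ and $C_2'(d,\boldsymbol r,\boldsymbol\sigma,p,q)$, depending only on the parameters indicated, such that for all $R>0$ and all integers $D\ge C_1(d,\boldsymbol\sigma,p)$, $$\sup_{s\in\mathcal S(\boldsymbol r,\boldsymbol\sigma,p,p',R)}\ \inf_{t\in\bigcup_{m\in\mathcal M_D}S_{(m,\boldsymbol r)}}\|s-t\|_q\le C_2'(d,\boldsymbol r,\boldsymbol\sigma,p,q)\,R\,D^{-H(\boldsymbol\sigma)/d}.$$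
   Context: $\mathbb N=\{0,1,2,\dots\}$ and $(x)_+=\max\{x,0\}$. A dyadic rectangle of $[0,1]^d$ is a product $I_1\times\dots\times I_d$ where, for each $l$, $I_l=[0,2^{-j_l}]$ or $I_l=(k_l2^{-j_l},(k_l+1)2^{-j_l}]$ with $j_l\in\mathbb N$, $k_l\in\{1,\dots,2^{j_l}-1\}$. For $D\ge1$, $\mathcal M_D$ is the set of all partitions of $[0,1]^d$ into $D$ dyadic rectangles. For a partition $m$ into dyadic rectangles, $S_{(m,\boldsymbol r)}$ is the space of functions on $[0,1]^d$ which, on each rectangle of $m$, are polynomial of degree $\le r_l$ in the $l$-th variable, $l=1,\dots,d$. For $0<p\le\infty$, $\mathbb L_p([0,1]^d)$ is the space of real measurable functions with finite Lebesgue (quasi-)norm $\|\cdot\|_p$ (essential supremum if $p=\infty$), functions being identified when equal almost everywhere. For $\boldsymbol\sigma\in(0,\infty)^d$: $\underline{\boldsymbol\sigma}=\min_l\sigma_l$ and $H(\boldsymbol\sigma)=\big(\frac1d\sum_{l=1}^d\frac1{\sigma_l}\big)^{-1}$. For $j\in\mathbb N$, $\mathcal D_j^{\boldsymbol\sigma}$ is the set of all dyadic rectangles $I_1\times\dots\times I_d$ such that each $I_l$ has length $2^{-\lfloor j\underline{\boldsymbol\sigma}/\sigma_l\rfloor}$; it is a partition of $[0,1]^d$. $\Pi_k^{\boldsymbol r,\boldsymbol\sigma}$ is the set of functions on $[0,1]^d$ that are polynomial of degree $\le r_l$ in the $l$-th variable over each rectangle of $\mathcal D_k^{\boldsymbol\sigma}$.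 For $s\in\mathbb L_p([0,1]^d)$, $$e_{\boldsymbol r,\boldsymbol\sigma,p,k}(s)=\inf_{P\in\Pi_k^{\boldsymbol r,\boldsymbol\sigma}}\|s-P\|_p,$$ $$N_{\boldsymbol r,\boldsymbol\sigma,p,p'}(s)=\Big(\sum_{k\in\mathbb N}(2^{k\underline{\boldsymbol\sigma}}e_{\boldsymbol r,\boldsymbol\sigma,p,k}(s))^{p'}\Big)^{1/p'}\ (0<p'<\infty),\qquad N_{\boldsymbol r,\boldsymbol\sigma,p,\infty}(s)=\sup_{k\in\mathbb N}2^{k\underline{\boldsymbol\sigma}}e_{\boldsymbol r,\boldsymbol\sigma,p,k}(s),$$ and $\mathcal S(\boldsymbol r,\boldsymbol\sigma,p,p',R)=\{s\in\mathbb L_p([0,1]^d): N_{\boldsymbol r,\boldsymbol\sigma,p,p'}(s)\le R\}$. *)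

theory Defs
  imports
    "HOL-Analysis.Analysis"
    "HOL-Probability.Essential_Supremum"
    "HOL-Library.Disjoint_Sets"
begin

text \<open>The dimension is \<open>d = CARD('d)\<close>. Functions on the unit cube are represented by total
  functions on \<^typ>\<open>real ^ 'd\<close>; only their values on the cube matter, because all norms are
  taken with respect to Lebesgue measure restricted to the cube.\<close>

abbreviation unit_cube :: "(real ^ 'd) set" where
  "unit_cube \<equiv> cbox 0 1"

abbreviation cube_measure :: "(real ^ 'd) measure" where
  "cube_measure \<equiv> lebesgue_on unit_cube"


subsection \<open>Lebesgue (quasi-)norms\<close>

text \<open>For positive exponents only: the power \<open>x ^ a\<close> on \<open>[0, \<infinity>]\<close>, with \<open>\<infinity> ^ a = \<infinity>\<close>.\<close>

definition enn_powr :: "ennreal \<Rightarrow> real \<Rightarrow> ennreal" where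
  "enn_powr x a = (if x = \<infinity> then \<infinity> else ennreal (enn2real x powr a))"

text \<open>Exponents range over \<open>(0, \<infinity>]\<close>. The norm takes values in \<open>[0, \<infinity>]\<close>: it is \<open>\<infinity>\<close> for a
  measurable function outside the Lebesgue space.\<close>

definition Lp_norm :: "ennreal \<Rightarrow> (real ^ 'd \<Rightarrow> real) \<Rightarrow> ennreal" where
  "Lp_norm p f =
    (if p = \<infinity> then esssup cube_measure (\<lambda>x. ennreal \<bar>f x\<bar>)
     else enn_powr (\<integral>\<^sup>+ x. ennreal (\<bar>f x\<bar> powr enn2real p) \<partial>cube_measure) (1 / enn2real p))"

definition Lp_space :: "ennreal \<Rightarrow> (real ^ 'd \<Rightarrow> real) set" where
  "Lp_space p = {f \<in> borel_measurable cube_measure. Lp_norm p f < \<infinity>}"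


subsection \<open>Dyadic rectangles and partitions\<close>

definition dyadic_interval :: "nat \<Rightarrow> nat \<Rightarrow> real set" where
  "dyadic_interval j k =
    (if k = 0 then {0 .. 1 / 2 ^ j} else {real k / 2 ^ j <.. (real k + 1) / 2 ^ j})"

definition dyadic_rectangle :: "nat ^ 'd \<Rightarrow> nat ^ 'd \<Rightarrow> (real ^ 'd) set" where
  "dyadic_rectangle j k = {x. \<forall>l. x $ l \<in> dyadic_interval (j $ l) (k $ l)}"

definition dyadic_rectangles_of :: "nat ^ 'd \<Rightarrow> (real ^ 'd) set set" where
  "dyadic_rectangles_of j = {dyadic_rectangle j k | k. \<forall>l. k $ l < 2 ^ (j $ l)}"

definition dyadic_rectangles :: "(real ^ 'd) set set" where
  "dyadic_rectangles = (\<Union>j. dyadic_rectangles_of j)"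

definition dyadic_partitions :: "nat \<Rightarrow> (real ^ 'd) set set set" where
  "dyadic_partitions D =
    {m. m \<subseteq> dyadic_rectangles \<and> partition_on unit_cube m \<and> finite m \<and> card m = D}"


subsection \<open>Piecewise polynomials\<close>

definition coord_polys :: "nat ^ 'd \<Rightarrow> (real ^ 'd \<Rightarrow> real) set" where
  "coord_polys r =
    {P. \<exists>c :: nat ^ 'd \<Rightarrow> real. \<forall>x.
      P x = (\<Sum>\<alpha> | \<forall>l. \<alpha> $ l \<le> r $ l. c \<alpha> * (\<Prod>l\<in>UNIV. x $ l ^ (\<alpha> $ l)))}"

lemma finite_multi_indices: "finite {\<alpha> :: nat ^ 'd. \<forall>l. \<alpha> $ l \<le> r $ l}"
proof -
  have "finite (vec_lambda ` (PiE (UNIV :: 'd set) (\<lambda>l. {..r $ l})))"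
    by (intro finite_imageI finite_PiE) auto
  moreover have "{\<alpha> :: nat ^ 'd. \<forall>l. \<alpha> $ l \<le> r $ l} \<subseteq> vec_lambda ` (PiE UNIV (\<lambda>l. {..r $ l}))"
  proof
    fix \<alpha> :: "nat ^ 'd" assume "\<alpha> \<in> {\<alpha>. \<forall>l. \<alpha> $ l \<le> r $ l}"
    then show "\<alpha> \<in> vec_lambda ` (PiE UNIV (\<lambda>l. {..r $ l}))"
      by (intro image_eqI[of _ _ "vec_nth \<alpha>"]) (auto simp: PiE_def)
  qed
  ultimately show ?thesis by (rule finite_subset[rotated])
qed

definition piecewise_polys :: "(real ^ 'd) set set \<Rightarrow> nat ^ 'd \<Rightarrow> (real ^ 'd \<Rightarrow> real) set" where
  "piecewise_polys m r = {t. \<forall>K\<in>m. \<exists>P\<in>coord_polys r. \<forall>x\<in>K. t x = P x}"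


subsection \<open>Anisotropic smoothness classes\<close>

definition min_smoothness :: "real ^ 'd \<Rightarrow> real" where
  "min_smoothness \<sigma> = Min (range (\<lambda>l. \<sigma> $ l))"

definition harmonic_mean :: "real ^ 'd \<Rightarrow> real" where
  "harmonic_mean \<sigma> = inverse (1 / real CARD('d) * (\<Sum>l\<in>UNIV. 1 / \<sigma> $ l))"

definition aniso_level :: "real ^ 'd \<Rightarrow> nat \<Rightarrow> nat ^ 'd" where
  "aniso_level \<sigma> j = (\<chi> l. nat \<lfloor>real j * min_smoothness \<sigma> / \<sigma> $ l\<rfloor>)"

definition aniso_dyadic :: "real ^ 'd \<Rightarrow> nat \<Rightarrow> (real ^ 'd) set set" where
  "aniso_dyadic \<sigma> j = dyadic_rectangles_of (aniso_level \<sigma> j)"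

definition approx_error ::
  "nat ^ 'd \<Rightarrow> real ^ 'd \<Rightarrow> ennreal \<Rightarrow> nat \<Rightarrow> (real ^ 'd \<Rightarrow> real) \<Rightarrow> ennreal" where
  "approx_error r \<sigma> p k s =
    (INF P \<in> piecewise_polys (aniso_dyadic \<sigma> k) r. Lp_norm p (\<lambda>x. s x - P x))"

definition approx_seminorm ::
  "nat ^ 'd \<Rightarrow> real ^ 'd \<Rightarrow> ennreal \<Rightarrow> ennreal \<Rightarrow> (real ^ 'd \<Rightarrow> real) \<Rightarrow> ennreal" where
  "approx_seminorm r \<sigma> p p' s =
    (let a = (\<lambda>k. ennreal (2 powr (real k * min_smoothness \<sigma>)) * approx_error r \<sigma> p k s)
     in if p' = \<infinity> then (SUP k. a k)
        else enn_powr (\<Sum>k. enn_powr (a k) (enn2real p')) (1 / enn2real p'))"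

definition smoothness_class ::
  "nat ^ 'd \<Rightarrow> real ^ 'd \<Rightarrow> ennreal \<Rightarrow> ennreal \<Rightarrow> real \<Rightarrow> (real ^ 'd \<Rightarrow> real) set" where
  "smoothness_class r \<sigma> p p' R = {s \<in> Lp_space p. approx_seminorm r \<sigma> p p' s \<le> ennreal R}"

end

theory Submission
  imports Defs "HOL-Computational_Algebra.Polynomial"
begin

text \<open>
  Let \<open>Q\<^sub>i = P\<^sub>i\<^sub>+\<^sub>1 - P\<^sub>i\<close>, where \<open>P\<^sub>i\<close> is a near-best \<open>L\<^sub>p\<close> approximation of \<open>s\<close> on the \<open>i\<close>-th
  anisotropic dyadic grid. Only the bounds \<open>\<parallel>s - P\<^sub>i\<parallel>\<^sub>p \<le> 2 R 2 powr (- i \<mu>)\<close>, with \<open>\<mu>\<close> the least smoothness,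
  are used; they hold for either value of \<open>p'\<close>. If \<open>q \<le> p\<close>, a single grid suffices.
  If \<open>p < q\<close>, start from the grid of level \<open>J\<close>, and call a cell of level \<open>i + 1\<close> (\<open>i \<ge> J\<close>) heavy if
  \<open>\<integral>\<bar>Q\<^sub>i\<bar> powr p\<close> over it exceeds a threshold chosen so that at most \<open>\<eta> 2 powr (J \<beta> - (i - J) \<epsilon>)\<close> cells
  are heavy. Refine exactly the cells that have heavy descendants: this leaves \<open>O(2 powr (J \<beta>))\<close> cells,
  and taking \<open>t = P\<^sub>j\<close> on a leaf of level \<open>j\<close>, only the restrictions of the \<open>Q\<^sub>i\<close> to light cells
  contribute to \<open>s - t\<close>. Nikolskii's inequality bounds these pointwise, hence in \<open>L\<^sub>q\<close>, and the sum over
  \<open>i\<close> is geometric because \<open>(1/p - 1/q) \<beta> < \<mu>\<close>, which is the assumption on \<open>H(\<sigma>)/d = \<mu> / \<beta>\<close>.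
\<close>

section \<open>Dyadic rectangles\<close>

text \<open>The parameter \<epsilon> balances two demands. The numbers of heavy cells must decay in
  k = i - J for the refinements to be summable, but allowing fewer heavy cells raises the threshold.
  If B is the error on level J, the integral of \<bar>Q_i\<bar> powr p is of order B powr p * 2 powr
  (- k \<mu> p). Markov's count makes the threshold this integral over 2 powr (J \<beta> - k
  \<epsilon>), and Nikolskii multiplies it by an inverse cell volume of order at most 2 powr ((J +
  k) \<beta>). The powers of J cancel: on light cells \<bar>Q_i\<bar> powr p is at most of order B
  powr p * 2 powr (k (\<beta> + \<epsilon> - \<mu> p)). Interpolating between sup bound and integral
  gives L_q norms of order B * 2 powr (k (\<delta> (\<beta> + \<epsilon>) - \<mu>)) with \<delta> =
  1/p - 1/q, so the strict inequality in the assumption is the room for a positive \<epsilon>. Two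
  obstacles shape the rest. For p < 1 there is no triangle inequality in L_p, so powers of maxima
  take its place. And s is only known to lie in L_p, so s - t is expanded pointwise, using that P_i
  tends to s almost everywhere.\<close>

text \<open>The division-free form turns existence, uniqueness and halving into arithmetic with
  \<open>x * 2 ^ j\<close>. The disjunct \<open>k = 0 \<and> x = 0\<close> is the closed left end of
  the first interval.\<close>

lemma dyadic_interval_unfold:
  "x \<in> dyadic_interval j k \<longleftrightarrow>
    (real k < x * 2 ^ j \<or> k = 0 \<and> x = 0) \<and> x * 2 ^ j \<le> real k + 1"
  by (auto simp: dyadic_interval_def field_simps zero_le_mult_iff zero_less_mult_iff)

lemma dyadic_interval_bounds:
  "{real k / 2 ^ j <..< (real k + 1) / 2 ^ j} \<subseteq> dyadic_interval j k"
  "dyadic_interval j k \<subseteq> {real k / 2 ^ j .. (real k + 1) / 2 ^ j}"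
  by (auto simp: dyadic_interval_def)

lemma dyadic_interval_right_end: "(real k + 1) / 2 ^ j \<in> dyadic_interval j k"
  by (auto simp: dyadic_interval_def field_simps)

lemma dyadic_interval_unique:
  assumes "x \<in> dyadic_interval j k" "x \<in> dyadic_interval j k'"
  shows "k = k'"
  using assms unfolding dyadic_interval_unfold by auto

lemma dyadic_interval_exists:
  assumes "0 \<le> x" "x \<le> 1"
  shows "\<exists>k < 2 ^ j. x \<in> dyadic_interval j k"
proof (cases "x = 0")
  case True
  then show ?thesis by (intro exI[of _ 0]) (auto simp: dyadic_interval_unfold)
next
  case False
  define y where "y = x * 2 ^ j"
  have y: "0 < y" "y \<le> 2 ^ j" using assms False by (auto simp: y_def)
  \<comment> \<open>Intervals are open on the left and closed on the right, hence the ceiling minus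
    one and not the floor: an integer \<open>y\<close> belongs to the interval that ends
    there.\<close>
  define k where "k = nat (\<lceil>y\<rceil> - 1)"
  have k: "int k = \<lceil>y\<rceil> - 1" using y(1) by (simp add: k_def)
  have "\<lceil>y\<rceil> \<le> 2 ^ j" using y(2) by (simp add: ceiling_le_iff)
  then have "int k < int (2 ^ j)" using k by simp
  then have "k < 2 ^ j" by (simp only: of_nat_less_iff)
  moreover have "real k = real_of_int \<lceil>y\<rceil> - 1" using k by linarith
  then have "real k < y" "y \<le> real k + 1" by linarith+
  ultimately show ?thesis by (auto simp: dyadic_interval_unfold y_def)
qed

lemma dyadic_interval_subset_unit:
  assumes "k < 2 ^ j" shows "dyadic_interval j k \<subseteq> {0..1}"
proof -
  have "real (k + 1) \<le> real (2 ^ j)" using assms by (simp only: of_nat_le_iff)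
  then have "(real k + 1) / 2 ^ j \<le> 1" by (simp add: field_simps)
  moreover have "0 \<le> real k / 2 ^ j" by simp
  ultimately have "{real k / 2 ^ j .. (real k + 1) / 2 ^ j} \<subseteq> {0..1}" by simp
  then show ?thesis using dyadic_interval_bounds(2)[of j k] by (rule subset_trans[rotated])
qed

lemma dyadic_interval_halves:
  "dyadic_interval j k = dyadic_interval (Suc j) (2 * k) \<union> dyadic_interval (Suc j) (Suc (2 * k))"
  by (auto simp: dyadic_interval_unfold)

text \<open>Going up one level replaces the index \<open>k\<close> by \<open>k div 2\<close>; this
  is iterated from \<open>j'\<close> down to \<open>j\<close>.\<close>

lemma dyadic_interval_coarsen:
  assumes "j \<le> j'" "k < 2 ^ j'"
  shows "\<exists>k0 < 2 ^ j. dyadic_interval j' k \<subseteq> dyadic_interval j k0"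
  using assms
proof (induction j' arbitrary: k rule: dec_induct)
  case base
  then show ?case by blast
next
  case (step n)
  have "k div 2 < 2 ^ n" using step.prems by auto
  then obtain k0 where k0: "k0 < 2 ^ j" "dyadic_interval n (k div 2) \<subseteq> dyadic_interval j k0"
    using step.IH by blast
  moreover have "dyadic_interval (Suc n) k \<subseteq> dyadic_interval n (k div 2)"
  proof -
    define h where "h = k div 2"
    have "k = 2 * h \<or> k = Suc (2 * h)" unfolding h_def by presburger
    then show ?thesis
      unfolding h_def[symmetric] using dyadic_interval_halves[of n h] by auto
  qed
  ultimately show ?case by blast
qed

lemma dyadic_interval_borel [measurable]: "dyadic_interval j k \<in> sets borel"
  by (simp add: dyadic_interval_def)

lemma dyadic_rectangle_borel [measurable]: "dyadic_rectangle j k \<in> sets borel"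
proof -
  have "dyadic_rectangle j k = (\<Inter>l. (\<lambda>x. x $ l) -` dyadic_interval (j $ l) (k $ l) \<inter> space borel)"
    by (auto simp: dyadic_rectangle_def)
  also have "\<dots> \<in> sets borel"
    by (intro sets.countable_INT'' measurable_sets[OF _ dyadic_interval_borel]) auto
  finally show ?thesis .
qed

section \<open>Volumes of dyadic rectangles and counting cells by volume\<close>

definition rect_lower :: "nat ^ 'd \<Rightarrow> nat ^ 'd \<Rightarrow> real ^ 'd" where
  "rect_lower j k = (\<chi> l. real (k $ l) / 2 ^ (j $ l))"

definition rect_upper :: "nat ^ 'd \<Rightarrow> nat ^ 'd \<Rightarrow> real ^ 'd" where
  "rect_upper j k = (\<chi> l. (real (k $ l) + 1) / 2 ^ (j $ l))"

lemma dyadic_rectangle_bounds: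
  "box (rect_lower j k) (rect_upper j k) \<subseteq> dyadic_rectangle j k"
  "dyadic_rectangle j k \<subseteq> cbox (rect_lower j k) (rect_upper j k)"
  using dyadic_interval_bounds
  by (fastforce simp: dyadic_rectangle_def rect_lower_def rect_upper_def mem_box_cart)+

lemma rect_sides:
  "rect_upper j k $ l - rect_lower j k $ l = 1 / 2 ^ (j $ l)"
  by (simp add: rect_lower_def rect_upper_def field_simps)

lemma emeasure_box_cart:
  fixes a b :: "real ^ 'd"
  assumes "\<And>l. a $ l \<le> b $ l"
  shows "emeasure lborel (box a b) = ennreal (\<Prod>l\<in>UNIV. b $ l - a $ l)"
    "emeasure lborel (cbox a b) = ennreal (\<Prod>l\<in>UNIV. b $ l - a $ l)"
proof -
  have "(\<Prod>i\<in>Basis. (b - a) \<bullet> i) = (\<Prod>i\<in>range (\<lambda>l. axis l (1::real)). (b - a) \<bullet> i)"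
    by (rule prod.cong) (auto simp: Basis_vec_def)
  also have "\<dots> = (\<Prod>l\<in>UNIV. b $ l - a $ l)"
    by (subst prod.reindex) (auto simp: inner_axis inj_on_def axis_eq_axis)
  finally have "(\<Prod>i\<in>Basis. (b - a) \<bullet> i) = (\<Prod>l\<in>UNIV. b $ l - a $ l)" .
  moreover have "\<forall>i\<in>Basis. a \<bullet> i \<le> b \<bullet> i"
    using assms by (auto simp: Basis_vec_def inner_axis)
  ultimately show "emeasure lborel (box a b) = ennreal (\<Prod>l\<in>UNIV. b $ l - a $ l)"
    "emeasure lborel (cbox a b) = ennreal (\<Prod>l\<in>UNIV. b $ l - a $ l)"
    by (simp_all add: emeasure_lborel_box_eq emeasure_lborel_cbox_eq)
qed

text \<open>A rectangle with half-open sides lies between an open and a closed box with the same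
  corners, and these have equal volume.\<close>

lemma emeasure_dyadic_rectangle:
  "emeasure lborel (dyadic_rectangle j k) = ennreal (1 / 2 ^ (\<Sum>l\<in>UNIV. j $ l))"
proof -
  have le: "rect_lower j k $ l \<le> rect_upper j k $ l" for l
    using rect_sides[of j k l] by (smt (verit) zero_le_divide_1_iff zero_le_power)
  have e: "(\<Prod>l\<in>UNIV. rect_upper j k $ l - rect_lower j k $ l) = 1 / 2 ^ (\<Sum>l\<in>UNIV. j $ l)"
    by (simp add: rect_sides prod_dividef power_sum)
  show ?thesis
  proof (rule antisym)
    show "emeasure lborel (dyadic_rectangle j k) \<le> ennreal (1 / 2 ^ (\<Sum>l\<in>UNIV. j $ l))"
      using emeasure_mono[OF dyadic_rectangle_bounds(2)[of j k], of lborel]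
      by (simp add: emeasure_box_cart le e)
    show "ennreal (1 / 2 ^ (\<Sum>l\<in>UNIV. j $ l)) \<le> emeasure lborel (dyadic_rectangle j k)"
      using emeasure_mono[OF dyadic_rectangle_bounds(1)[of j k], of lborel]
      by (simp add: emeasure_box_cart le e)
  qed
qed

lemma dyadic_rectangle_nonempty: "dyadic_rectangle j k \<noteq> {}"
proof -
  have "rect_upper j k \<in> dyadic_rectangle j k"
    by (simp add: dyadic_rectangle_def rect_upper_def dyadic_interval_right_end)
  then show ?thesis by blast
qed

lemma dyadic_rectangle_unique:
  "x \<in> dyadic_rectangle j k \<Longrightarrow> x \<in> dyadic_rectangle j k' \<Longrightarrow> k = k'"
  by (auto simp: dyadic_rectangle_def vec_eq_iff intro: dyadic_interval_unique)

lemma finite_dyadic_rectangles_of: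
  fixes j :: "nat ^ 'd"
  shows "finite (dyadic_rectangles_of j)"
proof -
  have "{k :: nat ^ 'd. \<forall>l. k $ l < 2 ^ (j $ l)} \<subseteq> {k. \<forall>l. k $ l \<le> (\<chi> l. 2 ^ (j $ l)) $ l}"
    by (auto intro: less_imp_le)
  then have "finite {k :: nat ^ 'd. \<forall>l. k $ l < 2 ^ (j $ l)}"
    using finite_multi_indices finite_subset by blast
  then show ?thesis by (simp add: dyadic_rectangles_of_def setcompr_eq_image)
qed

lemma partition_dyadic_rectangles_of:
  fixes j :: "nat ^ 'd"
  shows "partition_on unit_cube (dyadic_rectangles_of j)"
proof (rule partition_onI)
  show "\<Union> (dyadic_rectangles_of j) = unit_cube"
  proof (intro equalityI subsetI)
    fix x :: "real ^ 'd" assume "x \<in> \<Union> (dyadic_rectangles_of j)"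
    then obtain k where "\<And>l. k $ l < 2 ^ (j $ l)" "x \<in> dyadic_rectangle j k"
      by (auto simp: dyadic_rectangles_of_def)
    then show "x \<in> unit_cube"
      using dyadic_interval_subset_unit by (fastforce simp: dyadic_rectangle_def mem_box_cart)
  next
    fix x :: "real ^ 'd" assume "x \<in> unit_cube"
    then have "\<forall>l. \<exists>k < 2 ^ (j $ l). x $ l \<in> dyadic_interval (j $ l) k"
      using dyadic_interval_exists by (auto simp: mem_box_cart)
    then obtain k where k: "\<And>l. k l < 2 ^ (j $ l)" "\<And>l. x $ l \<in> dyadic_interval (j $ l) (k l)"
      by metis
    then have "x \<in> dyadic_rectangle j (\<chi> l. k l)" by (simp add: dyadic_rectangle_def)
    moreover have "dyadic_rectangle j (\<chi> l. k l) \<in> dyadic_rectangles_of j"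
      using k(1) by (auto simp: dyadic_rectangles_of_def)
    ultimately show "x \<in> \<Union> (dyadic_rectangles_of j)" by blast
  qed
next
  fix K K' assume "K \<in> dyadic_rectangles_of j" "K' \<in> dyadic_rectangles_of j" "K \<noteq> K'"
  then obtain k k' where "K = dyadic_rectangle j k" "K' = dyadic_rectangle j k'" "k \<noteq> k'"
    unfolding dyadic_rectangles_of_def by blast
  then show "disjnt K K'"
    unfolding disjnt_iff using dyadic_rectangle_unique by blast
next
  show "{} \<notin> dyadic_rectangles_of j"
    using dyadic_rectangle_nonempty by (auto simp: dyadic_rectangles_of_def)
qed

lemma dyadic_rectangles_of_coarsen:
  assumes "\<And>l. j $ l \<le> j' $ l" and "K \<in> dyadic_rectangles_of j'"
  shows "\<exists>K'\<in>dyadic_rectangles_of j. K \<subseteq> K'"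
proof -
  obtain k where K: "K = dyadic_rectangle j' k" and k: "\<And>l. k $ l < 2 ^ (j' $ l)"
    using assms(2) by (auto simp: dyadic_rectangles_of_def)
  have "\<forall>l. \<exists>k0 < 2 ^ (j $ l). dyadic_interval (j' $ l) (k $ l) \<subseteq> dyadic_interval (j $ l) k0"
    using dyadic_interval_coarsen[OF assms(1) k] by blast
  then obtain k0 where k0: "\<And>l. k0 l < 2 ^ (j $ l)"
      "\<And>l. dyadic_interval (j' $ l) (k $ l) \<subseteq> dyadic_interval (j $ l) (k0 l)"
    by metis
  have "K \<subseteq> dyadic_rectangle j (\<chi> l. k0 l)"
    using k0(2) by (auto simp: K dyadic_rectangle_def)
  moreover have "dyadic_rectangle j (\<chi> l. k0 l) \<in> dyadic_rectangles_of j"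
    using k0(1) by (auto simp: dyadic_rectangles_of_def)
  ultimately show ?thesis by blast
qed

lemma dyadic_rectangles_of_borel: "K \<in> dyadic_rectangles_of j \<Longrightarrow> K \<in> sets borel"
  by (auto simp: dyadic_rectangles_of_def)

lemma emeasure_dyadic_rectangles_of:
  "K \<in> dyadic_rectangles_of j \<Longrightarrow> emeasure lborel K = ennreal (1 / 2 ^ (\<Sum>l\<in>UNIV. j $ l))"
  by (auto simp: dyadic_rectangles_of_def emeasure_dyadic_rectangle)

text \<open>Volume count: the cells of one grid are disjoint and have equal measure, so only so many
  fit into \<open>S\<close>. With \<open>S\<close> the cube this bounds the size of the grid, with
  \<open>S\<close> a coarser cell the number of its descendants.\<close>

lemma card_dyadic_rectangles_of_within:
  assumes "A \<subseteq> dyadic_rectangles_of j" "\<Union>A \<subseteq> S" "S \<in> sets borel"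
    and "emeasure lborel S \<le> ennreal v" "0 \<le> v"
  shows "real (card A) \<le> v * 2 ^ (\<Sum>l\<in>UNIV. j $ l)"
proof -
  let ?n = "\<Sum>l\<in>UNIV. j $ l"
  have fin: "finite A" using assms(1) finite_dyadic_rectangles_of finite_subset by blast
  have dis: "disjoint_family_on (\<lambda>K. K) A"
    using partition_dyadic_rectangles_of[of j] assms(1)
    unfolding partition_on_def disjoint_family_on_def disjoint_def by blast
  have mem: "K \<in> dyadic_rectangles_of j" if "K \<in> A" for K
    using that assms(1) by blast
  have "ennreal (real (card A) * (1 / 2 ^ ?n)) = ennreal (\<Sum>K\<in>A. 1 / 2 ^ ?n)" by simp
  also have "\<dots> = (\<Sum>K\<in>A. ennreal (1 / 2 ^ ?n))" by (rule sum_ennreal[symmetric]) simp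
  also have "\<dots> = (\<Sum>K\<in>A. emeasure lborel K)"
    by (intro sum.cong refl emeasure_dyadic_rectangles_of[symmetric] mem)
  also have "\<dots> = emeasure lborel (\<Union>A)"
    using sum_emeasure[OF _ dis fin, of lborel] dyadic_rectangles_of_borel[OF mem] by auto
  also have "\<dots> \<le> emeasure lborel S"
    using assms(2,3) by (intro emeasure_mono) auto
  also have "\<dots> \<le> ennreal v" by fact
  finally show ?thesis
    using assms(5) by (simp add: ennreal_le_iff divide_le_eq)
qed

lemma card_dyadic_rectangles_of_le:
  fixes j :: "nat ^ 'd"
  shows "real (card (dyadic_rectangles_of j)) \<le> 2 ^ (\<Sum>l\<in>UNIV. j $ l)"
proof -
  have "emeasure lborel (unit_cube :: (real ^ 'd) set) = ennreal 1"
    by (subst emeasure_box_cart) auto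
  then show ?thesis
    using card_dyadic_rectangles_of_within[of "dyadic_rectangles_of j" j unit_cube 1]
      partition_dyadic_rectangles_of[of j]
    by (auto simp: partition_on_def)
qed

lemma card_dyadic_rectangles_of_children:
  assumes "K \<in> dyadic_rectangles_of j" "(\<Sum>l\<in>UNIV. j' $ l) \<le> (\<Sum>l\<in>UNIV. j $ l) + n"
  shows "card {K' \<in> dyadic_rectangles_of j'. K' \<subseteq> K} \<le> 2 ^ n"
proof -
  have "real (card {K' \<in> dyadic_rectangles_of j'. K' \<subseteq> K})
      \<le> 1 / 2 ^ (\<Sum>l\<in>UNIV. j $ l) * 2 ^ (\<Sum>l\<in>UNIV. j' $ l)"
    using assms(1) emeasure_dyadic_rectangles_of[OF assms(1)]
    by (intro card_dyadic_rectangles_of_within[of _ _ K]) (auto simp: dyadic_rectangles_of_borel)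
  also have "\<dots> \<le> 1 / 2 ^ (\<Sum>l\<in>UNIV. j $ l) * 2 ^ ((\<Sum>l\<in>UNIV. j $ l) + n)"
    using assms(2) by (intro mult_left_mono power_increasing) auto
  also have "\<dots> = real (2 ^ n)" by (simp add: power_add)
  finally show ?thesis by (simp only: of_nat_le_iff)
qed

section \<open>Splitting rectangles and padding partitions to a prescribed size\<close>

lemma dyadic_rectangle_halves:
  fixes K :: "(real ^ 'd) set"
  assumes "K \<in> dyadic_rectangles"
  obtains K1 K2 where "K1 \<in> dyadic_rectangles" "K2 \<in> dyadic_rectangles"
    "K1 \<inter> K2 = {}" "K1 \<union> K2 = K" "K1 \<noteq> {}" "K2 \<noteq> {}"
proof -
  obtain j k where K: "K = dyadic_rectangle j k" and k: "\<And>l. k $ l < 2 ^ (j $ l)"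
    using assms by (auto simp: dyadic_rectangles_def dyadic_rectangles_of_def)
  \<comment> \<open>Any coordinate direction will do for the cut; one exists because types are
    inhabited.\<close>
  obtain a :: 'd where True by simp
  define j' where "j' = (\<chi> l. if l = a then Suc (j $ l) else j $ l)"
  define k1 where "k1 = (\<chi> l. if l = a then 2 * k $ l else k $ l)"
  define k2 where "k2 = (\<chi> l. if l = a then Suc (2 * k $ l) else k $ l)"
  have "k1 $ l < 2 ^ (j' $ l) \<and> k2 $ l < 2 ^ (j' $ l)" for l
    using k[of l] by (auto simp: j'_def k1_def k2_def)
  then have "dyadic_rectangle j' k1 \<in> dyadic_rectangles" "dyadic_rectangle j' k2 \<in> dyadic_rectangles"
    by (auto simp: dyadic_rectangles_def dyadic_rectangles_of_def)
  moreover have "k1 $ a \<noteq> k2 $ a" by (simp add: k1_def k2_def)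
  then have "dyadic_rectangle j' k1 \<inter> dyadic_rectangle j' k2 = {}"
    using dyadic_rectangle_unique[of _ j' k1 k2] by (metis disjoint_iff)
  moreover have "dyadic_rectangle j' k1 \<union> dyadic_rectangle j' k2 = K"
  proof (intro set_eqI iffI)
    fix x assume "x \<in> dyadic_rectangle j' k1 \<union> dyadic_rectangle j' k2"
    then show "x \<in> K" using dyadic_interval_halves[of "j $ a" "k $ a"]
      unfolding K dyadic_rectangle_def j'_def k1_def k2_def by (auto split: if_splits)
  next
    fix x assume x: "x \<in> K"
    then have "x $ a \<in> dyadic_interval (Suc (j $ a)) (2 * k $ a) \<or>
        x $ a \<in> dyadic_interval (Suc (j $ a)) (Suc (2 * k $ a))"
      using dyadic_interval_halves[of "j $ a" "k $ a"] by (auto simp: K dyadic_rectangle_def)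
    with x show "x \<in> dyadic_rectangle j' k1 \<union> dyadic_rectangle j' k2"
      unfolding K dyadic_rectangle_def j'_def k1_def k2_def by auto
  qed
  ultimately show thesis using dyadic_rectangle_nonempty that by metis
qed

text \<open>\<open>dyadic_partitions D\<close> asks for exactly \<open>D\<close> rectangles, while
  the constructions below only bound their number from above. Halving one rectangle raises the count
  by exactly one, and a refinement keeps the piecewise polynomials at hand.\<close>

lemma dyadic_partition_pad:
  fixes m :: "(real ^ 'd) set set"
  assumes "m \<in> dyadic_partitions n" "n \<le> D"
  shows "\<exists>m'\<in>dyadic_partitions D. \<forall>K'\<in>m'. \<exists>K\<in>m. K' \<subseteq> K"
  using assms(2)
proof (induction D rule: dec_induct)
  case base
  then show ?case using assms(1) by blast
next
  case (step D)
  then obtain m' where m': "m' \<subseteq> dyadic_rectangles" "partition_on unit_cube m'" "finite m'"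
      "card m' = D" and ref: "\<forall>K'\<in>m'. \<exists>K\<in>m. K' \<subseteq> K"
    by (auto simp: dyadic_partitions_def)
  have "(0 :: real ^ 'd) \<in> unit_cube" by (simp add: mem_box_cart)
  then obtain K where K: "K \<in> m'" using m'(2) by (auto simp: partition_on_def)
  then have "K \<in> dyadic_rectangles" using m'(1) by blast
  then obtain K1 K2 where H: "K1 \<in> dyadic_rectangles" "K2 \<in> dyadic_rectangles"
    "K1 \<inter> K2 = {}" "K1 \<union> K2 = K" "K1 \<noteq> {}" "K2 \<noteq> {}"
    by (rule dyadic_rectangle_halves)
  define m2 where "m2 = insert K1 (insert K2 (m' - {K}))"
  have dis: "L \<inter> K = {}" if "L \<in> m' - {K}" for L
    using m'(2) K that by (auto simp: partition_on_def disjoint_def)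
  have n12: "K1 \<notin> m' - {K}" "K2 \<notin> m' - {K}" "K1 \<noteq> K2"
    using dis H by blast+
  have "card m2 = Suc D"
    using m'(3,4) n12 K by (simp add: m2_def card_Diff_singleton) (metis K Suc_pred card_gt_0_iff empty_iff)
  moreover have "partition_on unit_cube m2"
  proof (rule partition_onI)
    have "unit_cube = \<Union>m'" using m'(2) by (simp add: partition_on_def)
    also have "\<dots> = K \<union> \<Union>(m' - {K})" using K by blast
    also have "\<dots> = \<Union>m2" using H(4) by (auto simp: m2_def)
    finally show "\<Union>m2 = unit_cube" by simp
    show "{} \<notin> m2" using H m'(2) by (auto simp: m2_def partition_on_def)
    fix A B assume AB: "A \<in> m2" "B \<in> m2" "A \<noteq> B"
    have mm: "L \<inter> L' = {}" if "L \<in> m' - {K}" "L' \<in> m' - {K}" "L \<noteq> L'" for L L'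
      using m'(2) that by (auto simp: partition_on_def disjoint_def)
    have k12: "L \<inter> K1 = {} \<and> L \<inter> K2 = {}" if "L \<in> m' - {K}" for L
      using dis[OF that] H(4) by blast
    show "disjnt A B"
      using AB mm[of A B] k12[of A] k12[of B] H(3) unfolding m2_def disjnt_def
      by (elim insertE) (simp_all add: Int_commute)
  qed
  moreover have "m2 \<subseteq> dyadic_rectangles" using m'(1) H(1,2) by (auto simp: m2_def)
  moreover have "finite m2" using m'(3) by (simp add: m2_def)
  moreover have "\<forall>K'\<in>m2. \<exists>K\<in>m. K' \<subseteq> K"
  proof
    fix L assume "L \<in> m2"
    then have "\<exists>L'\<in>m'. L \<subseteq> L'" using H(4) K by (auto simp: m2_def)
    then show "\<exists>K\<in>m. L \<subseteq> K" using ref by (meson subset_trans)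
  qed
  ultimately show ?case by (auto simp: dyadic_partitions_def)
qed

lemma piecewise_polys_refine:
  assumes "\<forall>K'\<in>m'. \<exists>K\<in>m. K' \<subseteq> K" "t \<in> piecewise_polys m r"
  shows "t \<in> piecewise_polys m' r"
  unfolding piecewise_polys_def
proof (intro CollectI ballI)
  fix K' assume "K' \<in> m'"
  then obtain K where "K \<in> m" "K' \<subseteq> K" using assms(1) by blast
  then show "\<exists>P\<in>coord_polys r. \<forall>x\<in>K'. t x = P x"
    using assms(2) unfolding piecewise_polys_def by blast
qed

section \<open>Stopping-time partitions of nested grids\<close>

text \<open>The sum starts at \<open>j\<close> while exponents are counted from \<open>J\<close>, so
  that the factor \<open>\<rho> ^ (j - J)\<close> survives; a second summation, over
  \<open>j\<close>, relies on it.\<close>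

lemma sum_geometric_le:
  fixes \<rho> :: real
  assumes "0 \<le> \<rho>" "\<rho> < 1" "J \<le> j"
  shows "(\<Sum>i\<in>{j..<I}. \<rho> ^ (i - J)) \<le> \<rho> ^ (j - J) / (1 - \<rho>)"
proof (cases "j \<le> I")
  case True
  from True have "(\<Sum>i\<in>{j..<I}. \<rho> ^ (i - J)) * (1 - \<rho>) = \<rho> ^ (j - J) - \<rho> ^ (I - J)"
  proof (induction I rule: dec_induct)
    case base
    then show ?case by simp
  next
    case (step n)
    then have e: "Suc n - J = Suc (n - J)" using assms(3) by simp
    have "(\<Sum>i\<in>{j..<Suc n}. \<rho> ^ (i - J)) * (1 - \<rho>)
        = (\<Sum>i\<in>{j..<n}. \<rho> ^ (i - J)) * (1 - \<rho>) + \<rho> ^ (n - J) * (1 - \<rho>)"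
      using step.hyps by (simp add: distrib_right)
    then show ?case using step.IH e by (simp add: algebra_simps)
  qed
  also have "\<dots> \<le> \<rho> ^ (j - J)" using assms(1) by simp
  finally show ?thesis using assms(2) by (simp add: pos_le_divide_eq)
next
  case False
  then show ?thesis using assms by simp
qed

text \<open>A stopping time on nested partitions: each point descends from level \<open>J\<close>
  until its cell contains no member of any \<open>G i\<close> with \<open>i\<close> at least the
  current level. The cells split on level \<open>j\<close> are ancestors of members of
  \<open>G i\<close> with \<open>i \<ge> j\<close>, so their number is bounded by a geometric tail.
  Summing these tails over \<open>j\<close> gives the square of \<open>1 - \<rho>\<close>, and
  \<open>c\<close> counts the children made by one split.\<close>

lemma stopping_partition:
  fixes Dp G :: "nat \<Rightarrow> 'a set set" and N \<rho> :: real
  assumes part: "\<And>j. partition_on U (Dp j)"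
    and fin: "\<And>j. finite (Dp j)"
    and coarsen: "\<And>i j K. i \<le> j \<Longrightarrow> K \<in> Dp j \<Longrightarrow> \<exists>K'\<in>Dp i. K \<subseteq> K'"
    and children: "\<And>j K. K \<in> Dp j \<Longrightarrow> card {K' \<in> Dp (Suc j). K' \<subseteq> K} \<le> c"
    and G: "\<And>i. G i \<subseteq> Dp (Suc i)"
    and cardG: "\<And>i. J \<le> i \<Longrightarrow> real (card (G i)) \<le> N * \<rho> ^ (i - J)"
    and \<rho>: "0 \<le> \<rho>" "\<rho> < 1" and N: "0 \<le> N"
  obtains m lev where "partition_on U m" "finite m"
    "\<And>K. K \<in> m \<Longrightarrow> J \<le> lev K \<and> K \<in> Dp (lev K)"
    "\<And>K K' i. K \<in> m \<Longrightarrow> lev K \<le> i \<Longrightarrow> K' \<in> G i \<Longrightarrow> \<not> K' \<subseteq> K"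
    "real (card m) \<le> real (card (Dp J)) + real c * N / (1 - \<rho>)\<^sup>2"
proof -
  have finG: "finite (G i)" for i using G fin finite_subset by blast
  \<comment> \<open>A cardinality below 1 is 0: from some level \<open>I\<close> on all
    \<open>G i\<close> are empty, so every descent ends and the unions below are finite.\<close>
  have "(\<lambda>n. N * \<rho> ^ n) \<longlonglongrightarrow> N * 0"
    using \<rho> by (intro tendsto_mult_left LIMSEQ_realpow_zero) auto
  then have "\<forall>\<^sub>F n in sequentially. N * \<rho> ^ n < 1"
    by (intro order_tendstoD(2)[of _ "N * 0"]) auto
  then obtain n0 where n0: "\<And>n. n0 \<le> n \<Longrightarrow> N * \<rho> ^ n < 1"
    by (auto simp: eventually_sequentially)
  define I where "I = J + n0"
  have emptyG: "G i = {}" if "I \<le> i" for i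
  proof -
    have "J \<le> i" "n0 \<le> i - J" using that by (auto simp: I_def)
    then have "real (card (G i)) < 1" using cardG n0 by (meson le_less_trans)
    then show ?thesis using finG[of i] by simp
  qed
  \<comment> \<open>\<open>G i\<close> consists of cells of level \<open>Suc i\<close>, so
    \<open>i = j\<close> already refers to cells of the next level. It has to be included: on a leaf
    of level \<open>j\<close>, the step from level \<open>j\<close> to \<open>j + 1\<close> must be
    light too.\<close>
  define Inn where "Inn j = {K \<in> Dp j. \<exists>i\<ge>j. \<exists>K'\<in>G i. K' \<subseteq> K}" for j
  define cell where "cell j x = (THE K. K \<in> Dp j \<and> x \<in> K)" for j x
  have uniq: "K = K'" if "K \<in> Dp j" "K' \<in> Dp j" "x \<in> K" "x \<in> K'" for K K' j x
    using part[of j] that by (auto simp: partition_on_def disjoint_def)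
  have cellI: "cell j x = K" if "K \<in> Dp j" "x \<in> K" for j x K
    unfolding cell_def
  proof (rule the_equality)
    show "K \<in> Dp j \<and> x \<in> K" using that by simp
    show "L = K" if "L \<in> Dp j \<and> x \<in> L" for L
      using that \<open>K \<in> Dp j\<close> \<open>x \<in> K\<close> by (elim conjE) (rule uniq)
  qed
  have cell: "cell j x \<in> Dp j \<and> x \<in> cell j x" if "x \<in> U" for j x
  proof -
    have "U = \<Union>(Dp j)" using part by (auto simp: partition_on_def)
    then obtain K where "K \<in> Dp j" "x \<in> K" using \<open>x \<in> U\<close> by blast
    then show ?thesis using cellI by simp
  qed
  have cell_sub: "cell j x \<subseteq> cell i x" if "i \<le> j" "x \<in> U" for i j x
  proof -
    have "cell j x \<in> Dp j" using cell[OF that(2)] by blast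
    then obtain K' where "K' \<in> Dp i" "cell j x \<subseteq> K'" using coarsen[OF \<open>i \<le> j\<close>] by blast
    moreover from this have "cell i x = K'" using cell[OF that(2)] cellI by blast
    ultimately show ?thesis by simp
  qed
  have DpU: "K \<subseteq> U" if "K \<in> Dp j" for K j using part[of j] that by (auto simp: partition_on_def)
  have Dp_ne: "K \<noteq> {}" if "K \<in> Dp j" for K j using part[of j] that by (auto simp: partition_on_def)
  have card_Inn: "real (card (Inn j)) \<le> N * \<rho> ^ (j - J) / (1 - \<rho>)" if "J \<le> j" for j
  proof -
    \<comment> \<open>The ancestor on level \<open>j\<close> is read off from an arbitrary point of
      \<open>K'\<close>, which exists because members of a partition are nonempty.\<close>
    define anc where "anc K' = cell j (SOME x. x \<in> K')" for K' :: "'a set"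
    have "Inn j \<subseteq> (\<Union>i\<in>{j..<I}. anc ` G i)"
    proof
      fix K assume "K \<in> Inn j"
      then obtain i K' where *: "K \<in> Dp j" "j \<le> i" "K' \<in> G i" "K' \<subseteq> K" by (auto simp: Inn_def)
      then have "K' \<noteq> {}" using G Dp_ne by blast
      then have "anc K' = K" unfolding anc_def using cellI *(1,4) some_in_eq by blast
      moreover have "i < I" using emptyG[of i] *(3) by force
      ultimately show "K \<in> (\<Union>i\<in>{j..<I}. anc ` G i)" using *(2,3) by force
    qed
    then have "card (Inn j) \<le> card (\<Union>i\<in>{j..<I}. anc ` G i)"
      using finG by (intro card_mono) auto
    also have "\<dots> \<le> (\<Sum>i\<in>{j..<I}. card (anc ` G i))" by (rule card_UN_le) simp
    also have "\<dots> \<le> (\<Sum>i\<in>{j..<I}. card (G i))" by (intro sum_mono card_image_le finG)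
    finally have "real (card (Inn j)) \<le> (\<Sum>i\<in>{j..<I}. real (card (G i)))"
      by (metis of_nat_le_iff of_nat_sum)
    also have "\<dots> \<le> (\<Sum>i\<in>{j..<I}. N * \<rho> ^ (i - J))" using that by (intro sum_mono cardG) auto
    also have "\<dots> \<le> N * (\<rho> ^ (j - J) / (1 - \<rho>))"
      unfolding sum_distrib_left[symmetric]
      using N sum_geometric_le[OF \<rho> that] by (intro mult_left_mono) auto
    finally show ?thesis by simp
  qed
  define \<tau> where "\<tau> x = (LEAST j. J \<le> j \<and> cell j x \<notin> Inn j)" for x
  have I_ok: "J \<le> I \<and> cell I x \<notin> Inn I" for x
    using emptyG by (auto simp: Inn_def I_def)
  have \<tau>: "J \<le> \<tau> x" "cell (\<tau> x) x \<notin> Inn (\<tau> x)" "\<tau> x \<le> I" for x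
    unfolding \<tau>_def using LeastI[where P = "\<lambda>j. J \<le> j \<and> cell j x \<notin> Inn j", OF I_ok]
      Least_le[where P = "\<lambda>j. J \<le> j \<and> cell j x \<notin> Inn j", OF I_ok] by blast+
  have before: "cell j x \<in> Inn j" if "J \<le> j" "j < \<tau> x" for j x
    using not_less_Least[of j "\<lambda>j. J \<le> j \<and> cell j x \<notin> Inn j"] that unfolding \<tau>_def by blast
  define m where "m = (\<lambda>x. cell (\<tau> x) x) ` U"
  \<comment> \<open>Up to level \<open>\<tau> x\<close> the points \<open>x\<close> and
    \<open>y\<close> have the same cells, and the decision to stop depends on the cell only, so both
    stop on the same level. This is what makes the chosen cells disjoint.\<close>
  have same: "cell (\<tau> y) y = cell (\<tau> x) x" if "x \<in> U" "y \<in> cell (\<tau> x) x" for x y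
  proof -
    have yU: "y \<in> U" using that cell DpU by blast
    have eq: "cell j y = cell j x" if "j \<le> \<tau> x" for j
    proof -
      have "y \<in> cell j x" using cell_sub[OF that \<open>x \<in> U\<close>] \<open>y \<in> cell (\<tau> x) x\<close> by blast
      then show ?thesis using cellI cell[OF \<open>x \<in> U\<close>] by blast
    qed
    have "\<tau> y = \<tau> x"
      unfolding \<tau>_def[of y]
    proof (rule Least_equality)
      show "J \<le> \<tau> x \<and> cell (\<tau> x) y \<notin> Inn (\<tau> x)" using \<tau>(1,2)[of x] eq by simp
      fix j assume j: "J \<le> j \<and> cell j y \<notin> Inn j"
      show "\<tau> x \<le> j"
      proof (rule ccontr)
        assume "\<not> \<tau> x \<le> j"
        then show False using before[of j x] eq[of j] j by simp
      qed
    qed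
    then show ?thesis using eq by simp
  qed
  have pm: "partition_on U m"
  proof (rule partition_onI)
    show "\<Union>m = U" using cell DpU unfolding m_def by blast
    show "{} \<notin> m" using cell unfolding m_def by blast
    fix A B assume "A \<in> m" "B \<in> m" "A \<noteq> B"
    then obtain x y where xy: "x \<in> U" "y \<in> U" "A = cell (\<tau> x) x" "B = cell (\<tau> y) y"
      by (auto simp: m_def)
    show "disjnt A B"
    proof (rule ccontr)
      assume "\<not> disjnt A B"
      then obtain z where "z \<in> A" "z \<in> B" by (auto simp: disjnt_def)
      then show False using same[of x z] same[of y z] xy \<open>A \<noteq> B\<close> by simp
    qed
  qed
  \<comment> \<open>A leaf finer than level \<open>J\<close> has a parent at which the descent did
    not stop, so it is a child of a cell in \<open>Inn\<close>.\<close>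
  have sub: "m \<subseteq> Dp J \<union> (\<Union>j\<in>{J..<I}. \<Union>K\<in>Inn j. {K' \<in> Dp (Suc j). K' \<subseteq> K})"
  proof
    fix K assume "K \<in> m"
    then obtain x where x: "x \<in> U" "K = cell (\<tau> x) x" by (auto simp: m_def)
    show "K \<in> Dp J \<union> (\<Union>j\<in>{J..<I}. \<Union>K\<in>Inn j. {K' \<in> Dp (Suc j). K' \<subseteq> K})"
    proof (cases "\<tau> x = J")
      case True
      then show ?thesis using x cell by auto
    next
      case False
      then obtain j where j: "\<tau> x = Suc j" "J \<le> j" using \<tau>(1)[of x] by (cases "\<tau> x") auto
      have "j < I" using \<tau>(3)[of x] j by simp
      moreover have "cell j x \<in> Inn j" using before j by simp
      moreover have "K \<in> Dp (Suc j)" "K \<subseteq> cell j x"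
        using x j cell cell_sub[of j "Suc j" x] by auto
      ultimately show ?thesis using j(2) by fastforce
    qed
  qed
  have finInn: "finite (Inn j)" for j using fin[of j] by (simp add: Inn_def)
  have finm: "finite m"
    by (rule finite_subset[OF sub]) (use fin finInn in auto)
  have "card m \<le> card (Dp J) + card (\<Union>j\<in>{J..<I}. \<Union>K\<in>Inn j. {K' \<in> Dp (Suc j). K' \<subseteq> K})"
    using fin finInn by (intro order_trans[OF card_mono[OF _ sub] card_Un_le]) auto
  also have "card (\<Union>j\<in>{J..<I}. \<Union>K\<in>Inn j. {K' \<in> Dp (Suc j). K' \<subseteq> K})
      \<le> (\<Sum>j\<in>{J..<I}. card (\<Union>K\<in>Inn j. {K' \<in> Dp (Suc j). K' \<subseteq> K}))"
    by (rule card_UN_le) simp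
  also have "\<dots> \<le> (\<Sum>j\<in>{J..<I}. \<Sum>K\<in>Inn j. card {K' \<in> Dp (Suc j). K' \<subseteq> K})"
    by (intro sum_mono card_UN_le finInn)
  also have "\<dots> \<le> (\<Sum>j\<in>{J..<I}. \<Sum>K\<in>Inn j. c)"
    by (intro sum_mono children) (auto simp: Inn_def)
  finally have "card m \<le> card (Dp J) + (\<Sum>j\<in>{J..<I}. card (Inn j) * c)" by simp
  then have "real (card m) \<le> real (card (Dp J) + (\<Sum>j\<in>{J..<I}. card (Inn j) * c))"
    by (simp only: of_nat_le_iff)
  also have "\<dots> = real (card (Dp J)) + real c * (\<Sum>j\<in>{J..<I}. real (card (Inn j)))"
    by (simp add: sum_distrib_left mult.commute)
  also have "(\<Sum>j\<in>{J..<I}. real (card (Inn j))) \<le> (\<Sum>j\<in>{J..<I}. N * \<rho> ^ (j - J) / (1 - \<rho>))"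
    by (intro sum_mono card_Inn) auto
  also have "\<dots> = N / (1 - \<rho>) * (\<Sum>j\<in>{J..<I}. \<rho> ^ (j - J))"
    by (simp add: sum_distrib_left)
  also have "\<dots> \<le> N / (1 - \<rho>) * (1 / (1 - \<rho>))"
    using sum_geometric_le[OF \<rho>, of J J I] N \<rho> by (intro mult_left_mono) auto
  finally have cm: "real (card m) \<le> real (card (Dp J)) + real c * N / (1 - \<rho>)\<^sup>2"
    by (simp add: mult_left_mono power2_eq_square)
  have "\<forall>K\<in>m. \<exists>j. J \<le> j \<and> K \<in> Dp j \<and> (\<forall>i\<ge>j. \<forall>K'\<in>G i. \<not> K' \<subseteq> K)"
  proof
    fix K assume "K \<in> m"
    then obtain x where x: "x \<in> U" "K = cell (\<tau> x) x" by (auto simp: m_def)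
    then have "J \<le> \<tau> x \<and> K \<in> Dp (\<tau> x) \<and> (\<forall>i\<ge>\<tau> x. \<forall>K'\<in>G i. \<not> K' \<subseteq> K)"
      using \<tau>(1,2)[of x] cell[of x "\<tau> x"] by (auto simp: Inn_def)
    then show "\<exists>j. J \<le> j \<and> K \<in> Dp j \<and> (\<forall>i\<ge>j. \<forall>K'\<in>G i. \<not> K' \<subseteq> K)" by blast
  qed
  then obtain lev where "\<forall>K\<in>m. J \<le> lev K \<and> K \<in> Dp (lev K) \<and> (\<forall>i\<ge>lev K. \<forall>K'\<in>G i. \<not> K' \<subseteq> K)"
    by metis
  then show thesis using pm cm finm by (intro that[of m lev]) blast+
qed

section \<open>Nikolskii's inequality\<close>

definition lagrange_basis :: "(nat \<Rightarrow> real) \<Rightarrow> nat \<Rightarrow> nat \<Rightarrow> real \<Rightarrow> real" where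
  "lagrange_basis t n i x = (\<Prod>j\<in>{..n} - {i}. (x - t j) / (t i - t j))"

text \<open>Both sides are polynomials of degree at most \<open>n\<close> in \<open>x\<close> and
  agree at the \<open>n + 1\<close> distinct nodes. Monomials suffice because the elements of
  \<open>coord_polys\<close> are linear combinations of products of them.\<close>

lemma lagrange_monomial:
  assumes inj: "inj_on t {..n}" and "a \<le> n"
  shows "x ^ a = (\<Sum>i\<le>n. t i ^ a * lagrange_basis t n i x)"
proof -
  define b where "b i = (\<Prod>j\<in>{..n} - {i}. smult (1 / (t i - t j)) [:- t j, 1:])" for i
  define q where "q = (\<Sum>i\<le>n. smult (t i ^ a) (b i))"
  have b: "poly (b i) y = lagrange_basis t n i y" for i y
    by (simp add: b_def lagrange_basis_def poly_prod diff_divide_distrib)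
  have q: "poly q y = (\<Sum>i\<le>n. t i ^ a * lagrange_basis t n i y)" for y
    by (simp add: q_def poly_sum b)
  have "degree (b i) \<le> n" if "i \<le> n" for i
  proof -
    have "degree (b i) \<le> sum (degree \<circ> (\<lambda>j. smult (1 / (t i - t j)) [:- t j, 1:])) ({..n} - {i})"
      unfolding b_def by (rule degree_prod_sum_le) simp
    also have "\<dots> \<le> (\<Sum>j\<in>{..n} - {i}. 1)" by (intro sum_mono) simp
    also have "\<dots> = n" using that by simp
    finally show ?thesis .
  qed
  then have "degree q \<le> n"
    unfolding q_def by (intro degree_sum_le) (auto intro: order_trans[OF degree_smult_le])
  moreover have "card (t ` {..n}) = Suc n" using inj by (simp add: card_image)
  moreover have "poly (monom 1 a) y = poly q y" if "y \<in> t ` {..n}" for y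
  proof -
    from that obtain k where k: "k \<le> n" "y = t k" by auto
    have "lagrange_basis t n i y = (if i = k then 1 else 0)" if "i \<le> n" for i
    proof (cases "i = k")
      case True
      have f: "(y - t j) / (t i - t j) = 1" if "j \<in> {..n} - {i}" for j
        using inj that k \<open>i = k\<close> by (auto simp: inj_on_def)
      have "lagrange_basis t n i y = 1"
        unfolding lagrange_basis_def by (intro prod.neutral ballI f)
      then show ?thesis using True by simp
    next
      case False
      then have "k \<in> {..n} - {i}" using k by simp
      then have "lagrange_basis t n i y = 0"
        unfolding lagrange_basis_def by (intro prod_zero) (auto simp: k(2))
      with False show ?thesis by simp
    qed
    then have "poly q y = (\<Sum>i\<le>n. if i = k then t i ^ a else 0)"
      unfolding q by (intro sum.cong) auto
    then show ?thesis using k by (simp add: poly_monom)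
  qed
  ultimately have "monom 1 a = q"
    using \<open>a \<le> n\<close> by (intro poly_eqI_degree[of "t ` {..n}"]) (auto simp: degree_monom_eq)
  then show ?thesis using q[of x] by (metis mult_1 poly_monom)
qed

text \<open>Each of the \<open>n\<close> factors is at most \<open>w / (w / (n + 1))\<close>. The
  length \<open>w\<close> cancels, which is why one constant in Nikolskii's inequality serves boxes
  of all shapes.\<close>

lemma lagrange_basis_bound:
  assumes "i \<le> n" "0 < w"
    and "\<And>j. j \<le> n \<Longrightarrow> \<bar>x - t j\<bar> \<le> w"
    and "\<And>j. j \<le> n \<Longrightarrow> j \<noteq> i \<Longrightarrow> w / (real n + 1) \<le> \<bar>t i - t j\<bar>"
  shows "\<bar>lagrange_basis t n i x\<bar> \<le> (real n + 1) ^ n"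
proof -
  have "\<bar>(x - t j) / (t i - t j)\<bar> \<le> real n + 1" if "j \<in> {..n} - {i}" for j
  proof -
    have "0 < w / (real n + 1)" using assms(2) by simp
    have "\<bar>x - t j\<bar> / \<bar>t i - t j\<bar> \<le> w / (w / (real n + 1))"
      using assms(2) assms(3)[of j] assms(4)[of j] that \<open>0 < w / (real n + 1)\<close>
      by (intro frac_le) auto
    also have "\<dots> = real n + 1" using assms(2) by simp
    finally show ?thesis by simp
  qed
  then have "\<bar>lagrange_basis t n i x\<bar> \<le> (\<Prod>j\<in>{..n} - {i}. real n + 1)"
    unfolding lagrange_basis_def abs_prod by (intro prod_mono) auto
  also have "\<dots> = (real n + 1) ^ n" using assms(1) by simp
  finally show ?thesis .
qed

text \<open>Tensor product of the one-dimensional formula: expanding a product over coordinates of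
  sums over nodes yields a sum over functions \<open>\<beta>\<close> that pick one node index per
  coordinate.\<close>

lemma coord_polys_interpolation:
  fixes r :: "nat ^ 'd"
  assumes P: "P \<in> coord_polys r" and inj: "\<And>l. inj_on (t l) {..r $ l}"
  shows "P x = (\<Sum>\<beta>\<in>Pi\<^sub>E UNIV (\<lambda>l. {..r $ l}).
    P (\<chi> l. t l (\<beta> l)) * (\<Prod>l\<in>UNIV. lagrange_basis (t l) (r $ l) (\<beta> l) (x $ l)))"
proof -
  let ?A = "{\<alpha> :: nat ^ 'd. \<forall>l. \<alpha> $ l \<le> r $ l}" and ?B = "Pi\<^sub>E (UNIV :: 'd set) (\<lambda>l. {..r $ l})"
  let ?L = "\<lambda>\<beta>. \<Prod>l\<in>UNIV. lagrange_basis (t l) (r $ l) (\<beta> l) (x $ l)"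
  obtain c where c: "\<And>y. P y = (\<Sum>\<alpha>\<in>?A. c \<alpha> * (\<Prod>l\<in>UNIV. y $ l ^ (\<alpha> $ l)))"
    using P by (auto simp: coord_polys_def)
  have m: "(\<Prod>l\<in>UNIV. x $ l ^ (\<alpha> $ l)) = (\<Sum>\<beta>\<in>?B. (\<Prod>l\<in>UNIV. t l (\<beta> l) ^ (\<alpha> $ l)) * ?L \<beta>)"
    if "\<alpha> \<in> ?A" for \<alpha>
  proof -
    have "(\<Prod>l\<in>UNIV. x $ l ^ (\<alpha> $ l))
        = (\<Prod>l\<in>UNIV. \<Sum>i\<le>r $ l. t l i ^ (\<alpha> $ l) * lagrange_basis (t l) (r $ l) i (x $ l))"
      using that by (intro prod.cong refl lagrange_monomial inj) auto
    also have "\<dots> = (\<Sum>\<beta>\<in>?B. \<Prod>l\<in>UNIV. t l (\<beta> l) ^ (\<alpha> $ l) * lagrange_basis (t l) (r $ l) (\<beta> l) (x $ l))"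
      by (rule prod_sum_PiE) auto
    finally show ?thesis by (simp add: prod.distrib)
  qed
  have "P x = (\<Sum>\<alpha>\<in>?A. \<Sum>\<beta>\<in>?B. c \<alpha> * (\<Prod>l\<in>UNIV. t l (\<beta> l) ^ (\<alpha> $ l)) * ?L \<beta>)"
    unfolding c by (intro sum.cong refl) (simp add: m sum_distrib_left mult.assoc)
  also have "\<dots> = (\<Sum>\<beta>\<in>?B. \<Sum>\<alpha>\<in>?A. c \<alpha> * (\<Prod>l\<in>UNIV. t l (\<beta> l) ^ (\<alpha> $ l)) * ?L \<beta>)"
    by (rule sum.swap)
  also have "\<dots> = (\<Sum>\<beta>\<in>?B. P (\<chi> l. t l (\<beta> l)) * ?L \<beta>)"
    unfolding c by (simp add: sum_distrib_right)
  finally show ?thesis .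
qed

text \<open>Comparison with the largest summand gives one inequality for all
  \<open>p \<ge> 0\<close>, where convexity would need \<open>p \<ge> 1\<close> and subadditivity
  \<open>p \<le> 1\<close>.\<close>

lemma sum_powr_le:
  fixes v :: "'a \<Rightarrow> real"
  assumes "finite B" "\<And>b. b \<in> B \<Longrightarrow> 0 \<le> v b" "0 \<le> p"
  shows "(\<Sum>b\<in>B. v b) powr p \<le> real (card B) powr p * (\<Sum>b\<in>B. v b powr p)"
proof (cases "B = {}")
  case False
  have "Max (v ` B) \<in> v ` B" using False assms(1) by (intro Max_in) auto
  then obtain b0 where "b0 \<in> B" "v b0 = Max (v ` B)" by auto
  then have b0: "b0 \<in> B" "\<And>b. b \<in> B \<Longrightarrow> v b \<le> v b0" using assms(1) by auto
  have "(\<Sum>b\<in>B. v b) \<le> real (card B) * v b0"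
    using b0(2) sum_bounded_above by blast
  then have "(\<Sum>b\<in>B. v b) powr p \<le> (real (card B) * v b0) powr p"
    using assms by (intro powr_mono2 sum_nonneg) auto
  also have "\<dots> = real (card B) powr p * v b0 powr p"
    using assms(2) b0(1) by (simp add: powr_mult)
  also have "\<dots> \<le> real (card B) powr p * (\<Sum>b\<in>B. v b powr p)"
    using assms b0(1) by (intro mult_left_mono member_le_sum) auto
  finally show ?thesis .
qed simp

text \<open>In direction \<open>l\<close> the box is cut into \<open>r $ l + 1\<close> pieces of
  length \<open>h $ l\<close>, and \<open>u\<close> runs through the corner piece. The nodes, one
  per piece, then stay inside the box for every such \<open>u\<close> and have the spacing that
  \<open>lagrange_basis_bound\<close> asks for. The freedom of \<open>u\<close> is what allows
  averaging.\<close>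

lemma coord_polys_pointwise_bound:
  fixes r :: "nat ^ 'd"
  assumes P: "P \<in> coord_polys r" and ab: "\<And>l. a $ l < b $ l"
    and x: "x \<in> cbox a b"
    and h: "\<And>l. h $ l = (b $ l - a $ l) / (real (r $ l) + 1)"
    and u: "u \<in> box a (a + h)"
  shows "\<bar>P x\<bar> \<le> (\<Prod>l\<in>UNIV. (real (r $ l) + 1) ^ (r $ l)) *
    (\<Sum>\<beta>\<in>Pi\<^sub>E UNIV (\<lambda>l. {..r $ l}). \<bar>P (u + (\<chi> l. real (\<beta> l) * h $ l))\<bar>)"
    and "\<And>\<beta>. \<beta> \<in> Pi\<^sub>E UNIV (\<lambda>l. {..r $ l}) \<Longrightarrow> u + (\<chi> l. real (\<beta> l) * h $ l) \<in> box a b"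
proof -
  let ?B = "Pi\<^sub>E (UNIV :: 'd set) (\<lambda>l. {..r $ l})"
  define t where "t l i = u $ l + real i * h $ l" for l i
  have hpos: "0 < h $ l" for l using ab[of l] by (simp add: h)
  have ul: "a $ l < u $ l" "u $ l < a $ l + h $ l" for l
    using u by (auto simp: mem_box_cart)
  have hb: "(real (r $ l) + 1) * h $ l = b $ l - a $ l" for l by (simp add: h)
  have t: "a $ l < t l i" "t l i < b $ l" if "i \<le> r $ l" for l i
  proof -
    have "0 \<le> real i * h $ l" using hpos[of l] by simp
    then show "a $ l < t l i" using ul(1)[of l] by (simp add: t_def)
    have "real i * h $ l \<le> real (r $ l) * h $ l" using that hpos[of l] by simp
    then show "t l i < b $ l" using ul(2)[of l] hb[of l] by (simp add: t_def algebra_simps)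
  qed
  have eq: "u + (\<chi> l. real (\<beta> l) * h $ l) = (\<chi> l. t l (\<beta> l))" for \<beta>
    by (simp add: vec_eq_iff t_def)
  show "u + (\<chi> l. real (\<beta> l) * h $ l) \<in> box a b" if "\<beta> \<in> ?B" for \<beta>
    unfolding eq using t that by (auto simp: mem_box_cart PiE_iff)
  have inj: "inj_on (t l) {..r $ l}" for l
    using hpos[of l] by (auto simp: inj_on_def t_def)
  have L: "\<bar>lagrange_basis (t l) (r $ l) (\<beta> l) (x $ l)\<bar> \<le> (real (r $ l) + 1) ^ (r $ l)"
    if "\<beta> \<in> ?B" for \<beta> l
  proof (rule lagrange_basis_bound[where w = "b $ l - a $ l"])
    show "\<beta> l \<le> r $ l" using that by auto
    show "0 < b $ l - a $ l" using ab by simp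
    have xl: "a $ l \<le> x $ l" "x $ l \<le> b $ l" using x by (auto simp: mem_box_cart)
    show "\<bar>x $ l - t l j\<bar> \<le> b $ l - a $ l" if "j \<le> r $ l" for j
      using t[OF that] xl by linarith
    show "(b $ l - a $ l) / (real (r $ l) + 1) \<le> \<bar>t l (\<beta> l) - t l j\<bar>" if "j \<noteq> \<beta> l" for j
    proof -
      have "1 \<le> \<bar>real (\<beta> l) - real j\<bar>" using that by linarith
      then have "1 * h $ l \<le> \<bar>real (\<beta> l) - real j\<bar> * h $ l"
        using hpos[of l] by (intro mult_right_mono) auto
      also have "\<dots> = \<bar>(real (\<beta> l) - real j) * h $ l\<bar>"
        using hpos[of l] by (simp add: abs_mult)
      also have "(real (\<beta> l) - real j) * h $ l = t l (\<beta> l) - t l j"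
        by (simp add: t_def algebra_simps)
      finally show ?thesis by (simp add: h)
    qed
  qed
  have "\<bar>P x\<bar> \<le> (\<Sum>\<beta>\<in>?B. \<bar>P (\<chi> l. t l (\<beta> l)) *
      (\<Prod>l\<in>UNIV. lagrange_basis (t l) (r $ l) (\<beta> l) (x $ l))\<bar>)"
    unfolding coord_polys_interpolation[OF P inj, of x] by (rule sum_abs)
  also have "\<dots> \<le> (\<Sum>\<beta>\<in>?B. \<bar>P (\<chi> l. t l (\<beta> l))\<bar> * (\<Prod>l\<in>UNIV. (real (r $ l) + 1) ^ (r $ l)))"
    unfolding abs_mult abs_prod by (intro sum_mono mult_left_mono prod_mono) (auto intro: L)
  finally show "\<bar>P x\<bar> \<le> (\<Prod>l\<in>UNIV. (real (r $ l) + 1) ^ (r $ l)) *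
      (\<Sum>\<beta>\<in>?B. \<bar>P (u + (\<chi> l. real (\<beta> l) * h $ l))\<bar>)"
    unfolding eq sum_distrib_right[symmetric] by (simp only: mult.commute)
qed

lemma coord_polys_borel: "P \<in> coord_polys r \<Longrightarrow> P \<in> borel_measurable borel"
proof -
  assume "P \<in> coord_polys r"
  then obtain c where "\<And>y. P y = (\<Sum>\<alpha> | \<forall>l. \<alpha> $ l \<le> r $ l. c \<alpha> * (\<Prod>l\<in>UNIV. y $ l ^ (\<alpha> $ l)))"
    by (auto simp: coord_polys_def)
  then have "P = (\<lambda>y. \<Sum>\<alpha> | \<forall>l. \<alpha> $ l \<le> r $ l. c \<alpha> * (\<Prod>l\<in>UNIV. y $ l ^ (\<alpha> $ l)))" by blast
  moreover have "continuous_on UNIV \<dots>" by (intro continuous_intros)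
  ultimately show ?thesis by (simp add: borel_measurable_continuous_onI)
qed

lemma nn_integral_lborel_translate:
  fixes f :: "'a :: euclidean_space \<Rightarrow> ennreal"
  assumes "f \<in> borel_measurable borel"
  shows "(\<integral>\<^sup>+ u. f (u + c) \<partial>lborel) = (\<integral>\<^sup>+ u. f u \<partial>lborel)"
proof -
  have "(\<integral>\<^sup>+ u. f u \<partial>lborel) = (\<integral>\<^sup>+ u. f u \<partial>distr lborel borel ((+) c))"
    by (simp add: lborel_distr_plus)
  also have "\<dots> = (\<integral>\<^sup>+ u. f (c + u) \<partial>lborel)"
    using assms by (subst nn_integral_distr) auto
  finally show ?thesis by (simp add: add.commute)
qed

text \<open>The Nikolskii inequality between the uniform norm and the \<open>L\<^sub>p\<close> norm: interpolate at a grid of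
  nodes and average over the translates of that grid.\<close>

lemma coord_polys_nikolskii:
  fixes r :: "nat ^ 'd"
  assumes "0 < p"
  shows "\<exists>C>0. \<forall>P\<in>coord_polys r. \<forall>a b. \<forall>x\<in>cbox a b. \<forall>K\<in>sets borel.
    (\<forall>l. a $ l < b $ l) \<longrightarrow> box a b \<subseteq> K \<longrightarrow>
      ennreal (\<bar>P x\<bar> powr p * (\<Prod>l\<in>UNIV. b $ l - a $ l))
        \<le> ennreal C * (\<integral>\<^sup>+ y. ennreal (\<bar>P y\<bar> powr p) * indicator K y \<partial>lborel)"
proof -
  let ?B = "Pi\<^sub>E (UNIV :: 'd set) (\<lambda>l. {..r $ l})"
  \<comment> \<open>\<open>L\<close> bounds a product of Lagrange basis functions, \<open>n\<close>
    counts the nodes, \<open>M\<close> comes from raising the pointwise bound to the power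
    \<open>p\<close>, and \<open>R\<close> is the ratio of the volumes of the box and of its corner
    piece.\<close>
  define L where "L = (\<Prod>l\<in>UNIV. (real (r $ l) + 1) ^ (r $ l))"
  define n where "n = real (card ?B)"
  define R where "R = (\<Prod>l\<in>UNIV. real (r $ l) + 1)"
  define M where "M = (L * n) powr p"
  define C where "C = R * (M * n)"
  have finB: "finite ?B" by (intro finite_PiE) auto
  have "(\<lambda>l. if l \<in> UNIV then 0 else undefined) \<in> ?B" by auto
  then have "0 < n" using finB by (auto simp: n_def card_gt_0_iff)
  have "0 < L" by (auto simp: L_def intro!: prod_pos)
  have "0 < R" by (auto simp: R_def intro!: prod_pos)
  have "0 < M" using \<open>0 < n\<close> \<open>0 < L\<close> by (simp add: M_def)
  have "ennreal (\<bar>P x\<bar> powr p * (\<Prod>l\<in>UNIV. b $ l - a $ l))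
        \<le> ennreal C * (\<integral>\<^sup>+ y. ennreal (\<bar>P y\<bar> powr p) * indicator K y \<partial>lborel)"
    if P: "P \<in> coord_polys r" and ab: "\<And>l. a $ l < b $ l" and x: "x \<in> cbox a b"
      and K: "box a b \<subseteq> K" "K \<in> sets borel" for P a b x K
  proof -
    have [measurable]: "P \<in> borel_measurable borel" using P by (rule coord_polys_borel)
    note K(2) [measurable]
    define h where "h = (\<chi> l. (b $ l - a $ l) / (real (r $ l) + 1))"
    have h: "h $ l = (b $ l - a $ l) / (real (r $ l) + 1)" for l by (simp add: h_def)
    have hpos: "0 < h $ l" for l using ab[of l] by (simp add: h)
    let ?s = "\<lambda>\<beta>. \<chi> l. real (\<beta> l) * h $ l"
    let ?I = "\<integral>\<^sup>+ y. ennreal (\<bar>P y\<bar> powr p) * indicator K y \<partial>lborel"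
    have pt: "\<bar>P x\<bar> powr p \<le> M * (\<Sum>\<beta>\<in>?B. \<bar>P (u + ?s \<beta>)\<bar> powr p)" if u: "u \<in> box a (a + h)" for u
    proof -
      have "\<bar>P x\<bar> powr p \<le> (L * (\<Sum>\<beta>\<in>?B. \<bar>P (u + ?s \<beta>)\<bar>)) powr p"
        using coord_polys_pointwise_bound(1)[OF P ab x h u] assms
        by (intro powr_mono2) (auto simp: L_def)
      also have "\<dots> = L powr p * (\<Sum>\<beta>\<in>?B. \<bar>P (u + ?s \<beta>)\<bar>) powr p"
        using \<open>0 < L\<close> by (simp add: powr_mult sum_nonneg)
      also have "\<dots> \<le> L powr p * (n powr p * (\<Sum>\<beta>\<in>?B. \<bar>P (u + ?s \<beta>)\<bar> powr p))"
        unfolding n_def using assms finB by (intro mult_left_mono sum_powr_le) auto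
      also have "\<dots> = M * (\<Sum>\<beta>\<in>?B. \<bar>P (u + ?s \<beta>)\<bar> powr p)"
        using \<open>0 < L\<close> \<open>0 < n\<close> by (simp add: M_def powr_mult)
      finally show ?thesis .
    qed
    have meas: "(\<lambda>y. ennreal (\<bar>P y\<bar> powr p) * indicator K y) \<in> borel_measurable borel"
      by measurable
    have "(\<Prod>l\<in>UNIV. b $ l - a $ l) = R * (\<Prod>l\<in>UNIV. h $ l)"
      unfolding R_def prod.distrib[symmetric] by (intro prod.cong) (auto simp: h)
    moreover have "emeasure lborel (box a (a + h)) = ennreal (\<Prod>l\<in>UNIV. h $ l)"
      using hpos by (subst emeasure_box_cart) (auto intro: less_imp_le)
    ultimately have "ennreal (\<bar>P x\<bar> powr p * (\<Prod>l\<in>UNIV. b $ l - a $ l))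
        = ennreal R * (ennreal (\<bar>P x\<bar> powr p) * emeasure lborel (box a (a + h)))"
      using \<open>0 < R\<close> hpos
      by (simp add: ennreal_mult[symmetric] prod_nonneg less_imp_le mult_ac)
    also have "ennreal (\<bar>P x\<bar> powr p) * emeasure lborel (box a (a + h))
        = (\<integral>\<^sup>+ u. ennreal (\<bar>P x\<bar> powr p) * indicator (box a (a + h)) u \<partial>lborel)"
      by (subst nn_integral_cmult_indicator) auto
    \<comment> \<open>Every node lies in \<open>K\<close>, so its indicator may be inserted, after
      which \<open>u\<close> may range over the whole space. Translation invariance then turns the
      term of each node into the same integral \<open>?I\<close>.\<close>
    also have "\<dots> \<le> (\<integral>\<^sup>+ u. ennreal M *
        (\<Sum>\<beta>\<in>?B. ennreal (\<bar>P (u + ?s \<beta>)\<bar> powr p) * indicator K (u + ?s \<beta>)) \<partial>lborel)"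
    proof (rule nn_integral_mono)
      fix u
      show "ennreal (\<bar>P x\<bar> powr p) * indicator (box a (a + h)) u
        \<le> ennreal M * (\<Sum>\<beta>\<in>?B. ennreal (\<bar>P (u + ?s \<beta>)\<bar> powr p) * indicator K (u + ?s \<beta>))"
      proof (cases "u \<in> box a (a + h)")
        case True
        have "u + ?s \<beta> \<in> K" if "\<beta> \<in> ?B" for \<beta>
          using coord_polys_pointwise_bound(2)[OF P ab x h True that] K(1) by blast
        then have "(\<Sum>\<beta>\<in>?B. ennreal (\<bar>P (u + ?s \<beta>)\<bar> powr p) * indicator K (u + ?s \<beta>))
            = (\<Sum>\<beta>\<in>?B. ennreal (\<bar>P (u + ?s \<beta>)\<bar> powr p))"
          by (intro sum.cong) auto
        also have "\<dots> = ennreal (\<Sum>\<beta>\<in>?B. \<bar>P (u + ?s \<beta>)\<bar> powr p)" by (rule sum_ennreal) simp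
        finally have "ennreal M * (\<Sum>\<beta>\<in>?B. ennreal (\<bar>P (u + ?s \<beta>)\<bar> powr p) * indicator K (u + ?s \<beta>))
            = ennreal (M * (\<Sum>\<beta>\<in>?B. \<bar>P (u + ?s \<beta>)\<bar> powr p))"
          using \<open>0 < M\<close> by (simp add: ennreal_mult sum_nonneg)
        then show ?thesis using pt[OF True] True by (simp add: ennreal_leI)
      qed simp
    qed
    also have "\<dots> = ennreal M * (\<Sum>\<beta>\<in>?B.
        \<integral>\<^sup>+ u. ennreal (\<bar>P (u + ?s \<beta>)\<bar> powr p) * indicator K (u + ?s \<beta>) \<partial>lborel)"
      by (subst nn_integral_cmult, measurable, subst nn_integral_sum, measurable)
    also have "\<dots> = ennreal M * (\<Sum>\<beta>\<in>?B. ?I)"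
      by (simp only: nn_integral_lborel_translate[OF meas])
    also have "(\<Sum>\<beta>\<in>?B. ?I) = ennreal n * ?I"
      by (simp add: n_def ennreal_of_nat_eq_real_of_nat)
    also have "ennreal R * (ennreal M * (ennreal n * ?I)) = ennreal C * ?I"
      using \<open>0 < R\<close> \<open>0 < M\<close> \<open>0 < n\<close> by (simp add: C_def ennreal_mult mult_ac)
    finally show ?thesis by (simp add: mult_left_mono)
  qed
  moreover have "0 < C" using \<open>0 < R\<close> \<open>0 < M\<close> \<open>0 < n\<close> by (simp add: C_def)
  ultimately show ?thesis by blast
qed

section \<open>Norms and geometric sums\<close>

lemma enn_powr_le_iff:
  assumes "0 < p" "0 \<le> E"
  shows "enn_powr X (1 / p) \<le> ennreal E \<longleftrightarrow> X \<le> ennreal (E powr p)"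
proof (cases X)
  case (real x)
  have "x powr (1 / p) \<le> E \<longleftrightarrow> x \<le> E powr p"
  proof
    assume "x powr (1 / p) \<le> E"
    then have "(x powr (1 / p)) powr p \<le> E powr p" using assms by (intro powr_mono2) auto
    then show "x \<le> E powr p" using assms real by (simp add: powr_powr)
  next
    assume "x \<le> E powr p"
    then have "x powr (1 / p) \<le> (E powr p) powr (1 / p)" using assms real by (intro powr_mono2) auto
    then show "x powr (1 / p) \<le> E" using assms by (simp add: powr_powr)
  qed
  then show ?thesis using real assms by (simp add: enn_powr_def)
qed (simp add: enn_powr_def top_unique)

lemma Lp_norm_le_iff:
  assumes "0 < p" "0 \<le> E"
  shows "Lp_norm (ennreal p) f \<le> ennreal E \<longleftrightarrow>
    (\<integral>\<^sup>+ x. ennreal (\<bar>f x\<bar> powr p) \<partial>cube_measure) \<le> ennreal (E powr p)"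
  using assms by (simp add: Lp_norm_def enn_powr_le_iff)

lemma space_cube_measure [simp]: "space cube_measure = unit_cube"
  by (simp add: space_restrict_space)

lemma sets_cube_measure: "K \<in> sets borel \<Longrightarrow> K \<subseteq> unit_cube \<Longrightarrow> K \<in> sets cube_measure"
  by (subst sets_restrict_space_iff) auto

lemma borel_measurable_cube_measure:
  "f \<in> borel_measurable borel \<Longrightarrow> f \<in> borel_measurable cube_measure"
  by (intro measurable_restrict_space1 measurable_completion) simp

lemma emeasure_cube_measure [simp]: "emeasure (cube_measure :: (real ^ 'd) measure) unit_cube = 1"
proof -
  have "emeasure (cube_measure :: (real ^ 'd) measure) unit_cube = emeasure lborel (unit_cube :: (real ^ 'd) set)"
    by (subst emeasure_restrict_space) auto
  also have "\<dots> = 1" by (subst emeasure_box_cart) auto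
  finally show ?thesis .
qed

text \<open>A bridge: the norms live on a restriction of the completed measure, translation
  invariance and box volumes on \<open>lborel\<close>.\<close>

lemma nn_integral_cube_measure_subset:
  assumes "K \<subseteq> unit_cube"
  shows "(\<integral>\<^sup>+ x. f x * indicator K x \<partial>cube_measure) = (\<integral>\<^sup>+ x. f x * indicator K x \<partial>lborel)"
proof -
  have "(\<integral>\<^sup>+ x. f x * indicator K x \<partial>cube_measure)
      = (\<integral>\<^sup>+ x. f x * indicator K x * indicator unit_cube x \<partial>lebesgue)"
    by (subst nn_integral_restrict_space) auto
  also have "\<dots> = (\<integral>\<^sup>+ x. f x * indicator K x \<partial>lebesgue)"
    using assms by (intro nn_integral_cong) (auto simp: indicator_def)
  finally show ?thesis by (simp only: nn_integral_completion)
qed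

text \<open>A piecewise polynomial is arbitrary outside the cube, so measurability can only be
  claimed on the cube. There it coincides with a finite sum of polynomials times indicators.\<close>

lemma piecewise_polys_measurable:
  assumes t: "t \<in> piecewise_polys m r" and m: "partition_on unit_cube m" "finite m" "m \<subseteq> sets borel"
  shows "t \<in> borel_measurable cube_measure"
proof -
  have "\<forall>K\<in>m. \<exists>P. P \<in> coord_polys r \<and> (\<forall>x\<in>K. t x = P x)"
    using t by (auto simp: piecewise_polys_def)
  then obtain P where P: "\<And>K. K \<in> m \<Longrightarrow> P K \<in> coord_polys r"
      "\<And>K x. K \<in> m \<Longrightarrow> x \<in> K \<Longrightarrow> t x = P K x"
    by metis
  have eq: "t x = (\<Sum>K\<in>m. indicator K x * P K x)" if x: "x \<in> unit_cube" for x
  proof -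
    obtain K where K: "K \<in> m" "x \<in> K" using x m(1) by (auto simp: partition_on_def)
    have "indicator L x * P L x = (if L = K then P K x else 0)" if L: "L \<in> m" for L
    proof (cases "L = K")
      case False
      then have "x \<notin> L" using m(1) K L by (auto simp: partition_on_def disjoint_def)
      with False show ?thesis by simp
    qed (use K in simp)
    then have "(\<Sum>L\<in>m. indicator L x * P L x) = (\<Sum>L\<in>m. if L = K then P K x else 0)"
      by (rule sum.cong[OF refl])
    then show ?thesis using K P(2) m(2) by simp
  qed
  have "(\<lambda>x. \<Sum>K\<in>m. indicator K x * P K x) \<in> borel_measurable borel"
  proof (rule borel_measurable_sum)
    fix K assume K: "K \<in> m"
    then have "K \<in> sets borel" using m(3) by blast
    then show "(\<lambda>x. indicator K x * P K x) \<in> borel_measurable borel"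
      using coord_polys_borel[OF P(1)[OF K]] by (intro borel_measurable_times) auto
  qed
  then have "(\<lambda>x. \<Sum>K\<in>m. indicator K x * P K x) \<in> borel_measurable cube_measure"
    by (rule borel_measurable_cube_measure)
  then show ?thesis
    by (rule measurable_cong[THEN iffD1, rotated]) (simp add: eq)
qed

lemma piecewise_polys_dyadic_measurable:
  "t \<in> piecewise_polys (dyadic_rectangles_of j) r \<Longrightarrow> t \<in> borel_measurable cube_measure"
  by (erule piecewise_polys_measurable)
    (auto intro: partition_dyadic_rectangles_of finite_dyadic_rectangles_of dyadic_rectangles_of_borel)

lemma coord_polys_diff:
  assumes "P \<in> coord_polys r" "Q \<in> coord_polys r"
  shows "(\<lambda>x. P x - Q x) \<in> coord_polys r"
proof -
  obtain c c' where "\<And>x. P x = (\<Sum>\<alpha> | \<forall>l. \<alpha> $ l \<le> r $ l. c \<alpha> * (\<Prod>l\<in>UNIV. x $ l ^ (\<alpha> $ l)))"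
      "\<And>x. Q x = (\<Sum>\<alpha> | \<forall>l. \<alpha> $ l \<le> r $ l. c' \<alpha> * (\<Prod>l\<in>UNIV. x $ l ^ (\<alpha> $ l)))"
    using assms by (auto simp: coord_polys_def)
  then show ?thesis
    unfolding coord_polys_def
    by (intro CollectI exI[of _ "\<lambda>\<alpha>. c \<alpha> - c' \<alpha>"]) (simp add: left_diff_distrib sum_subtractf)
qed

lemma dyadic_nikolskii:
  fixes r :: "nat ^ 'd"
  assumes "0 < p"
  shows "\<exists>C>0. \<forall>j. \<forall>K\<in>dyadic_rectangles_of j. \<forall>P\<in>coord_polys r. \<forall>Q. (\<forall>x\<in>K. Q x = P x) \<longrightarrow>
    (\<forall>x\<in>K. ennreal (\<bar>Q x\<bar> powr p) \<le> ennreal (C * 2 ^ (\<Sum>l\<in>UNIV. j $ l)) *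
        (\<integral>\<^sup>+ y. ennreal (\<bar>Q y\<bar> powr p) * indicator K y \<partial>cube_measure))"
proof -
  obtain C where C: "0 < C" and nik: "\<forall>P\<in>coord_polys r. \<forall>a b. \<forall>x\<in>cbox a b. \<forall>K\<in>sets borel.
    (\<forall>l. a $ l < b $ l) \<longrightarrow> box a b \<subseteq> K \<longrightarrow>
      ennreal (\<bar>P x\<bar> powr p * (\<Prod>l\<in>UNIV. b $ l - a $ l))
        \<le> ennreal C * (\<integral>\<^sup>+ y. ennreal (\<bar>P y\<bar> powr p) * indicator K y \<partial>lborel)"
    using coord_polys_nikolskii[OF assms, of r] by blast
  have "ennreal (\<bar>Q x\<bar> powr p) \<le> ennreal (C * 2 ^ (\<Sum>l\<in>UNIV. j $ l)) *
        (\<integral>\<^sup>+ y. ennreal (\<bar>Q y\<bar> powr p) * indicator K y \<partial>cube_measure)"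
    if K: "K \<in> dyadic_rectangles_of j" and P: "P \<in> coord_polys r" and Q: "\<And>x. x \<in> K \<Longrightarrow> Q x = P x"
      and x: "x \<in> K" for j K Q P x
  proof -
    let ?n = "\<Sum>l\<in>UNIV. j $ l"
    let ?I = "\<integral>\<^sup>+ y. ennreal (\<bar>P y\<bar> powr p) * indicator K y \<partial>lborel"
    obtain k where k: "K = dyadic_rectangle j k" using K by (auto simp: dyadic_rectangles_of_def)
    have Kc: "K \<subseteq> unit_cube" using K partition_dyadic_rectangles_of[of j] by (auto simp: partition_on_def)
    have lt: "rect_lower j k $ l < rect_upper j k $ l" for l
    proof -
      have "0 < 1 / (2 :: real) ^ (j $ l)" by simp
      then show ?thesis using rect_sides[of j k l] by linarith
    qed
    have side: "(\<Prod>l\<in>UNIV. rect_upper j k $ l - rect_lower j k $ l) = 1 / 2 ^ ?n"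
      by (simp add: rect_sides prod_dividef power_sum)
    have "x \<in> cbox (rect_lower j k) (rect_upper j k)"
      using x dyadic_rectangle_bounds(2) unfolding k by blast
    then have "ennreal (\<bar>P x\<bar> powr p * (1 / 2 ^ ?n)) \<le> ennreal C * ?I"
      using nik[rule_format, OF P _ dyadic_rectangles_of_borel[OF K] lt] dyadic_rectangle_bounds(1)[of j k]
      unfolding side k by blast
    then have "ennreal (2 ^ ?n) * ennreal (\<bar>P x\<bar> powr p * (1 / 2 ^ ?n)) \<le> ennreal (2 ^ ?n) * (ennreal C * ?I)"
      by (intro mult_left_mono) auto
    moreover have "ennreal (2 ^ ?n) * ennreal (\<bar>P x\<bar> powr p * (1 / 2 ^ ?n)) = ennreal (\<bar>P x\<bar> powr p)"
      by (subst ennreal_mult[symmetric]) auto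
    moreover have "ennreal (2 ^ ?n) * (ennreal C * ?I) = ennreal (C * 2 ^ ?n) * ?I"
      using C by (simp add: ennreal_mult mult_ac)
    moreover have "?I = (\<integral>\<^sup>+ y. ennreal (\<bar>Q y\<bar> powr p) * indicator K y \<partial>cube_measure)"
      unfolding nn_integral_cube_measure_subset[OF Kc]
      using Q by (intro nn_integral_cong) (auto simp: indicator_def)
    ultimately show ?thesis using Q[OF x] by simp
  qed
  with C show ?thesis by blast
qed

section \<open>Convergence almost everywhere and sums over levels\<close>

text \<open>The integrals have a finite sum, so the series of the
  \<open>\<bar>f n x\<bar> powr p\<close> is finite almost everywhere and its terms vanish in the
  limit. The geometric rate yields the whole sequence, not only a subsequence.\<close>

lemma AE_tendsto_zero_of_geometric_integrals:
  fixes f :: "nat \<Rightarrow> 'a \<Rightarrow> real"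
  assumes [measurable]: "\<And>n. f n \<in> borel_measurable M" and p: "0 < p" and a: "0 \<le> a" "a < 1" and c: "0 \<le> c"
    and int: "\<And>n. (\<integral>\<^sup>+ x. ennreal (\<bar>f n x\<bar> powr p) \<partial>M) \<le> ennreal (c * a ^ n)"
  shows "AE x in M. (\<lambda>n. f n x) \<longlonglongrightarrow> 0"
proof -
  have sm: "summable (\<lambda>n. c * a ^ n)" using a by (intro summable_mult summable_geometric) auto
  have "(\<integral>\<^sup>+ x. (\<Sum>n. ennreal (\<bar>f n x\<bar> powr p)) \<partial>M) = (\<Sum>n. \<integral>\<^sup>+ x. ennreal (\<bar>f n x\<bar> powr p) \<partial>M)"
    by (rule nn_integral_suminf) measurable
  also have "\<dots> \<le> (\<Sum>n. ennreal (c * a ^ n))" by (intro suminf_le int) auto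
  also have "\<dots> = ennreal (\<Sum>n. c * a ^ n)" using a c sm by (intro suminf_ennreal2) auto
  also have "\<dots> < \<infinity>" by simp
  finally have "AE x in M. (\<Sum>n. ennreal (\<bar>f n x\<bar> powr p)) \<noteq> \<infinity>"
    by (intro nn_integral_PInf_AE) auto
  then show ?thesis
  proof eventually_elim
    case (elim x)
    then have "summable (\<lambda>n. \<bar>f n x\<bar> powr p)" by (intro summable_suminf_not_top) auto
    then have "(\<lambda>n. \<bar>f n x\<bar> powr p) \<longlonglongrightarrow> 0" by (rule summable_LIMSEQ_zero)
    then have "(\<lambda>n. (\<bar>f n x\<bar> powr p) powr (1 / p)) \<longlonglongrightarrow> 0"
      by (rule tendsto_zero_powrI[where b = "1 / p"]) (use p in auto)
    then have "(\<lambda>n. \<bar>f n x\<bar>) \<longlonglongrightarrow> 0" using p by (simp add: powr_powr)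
    then show ?case by (rule tendsto_rabs_zero_cancel)
  qed
qed

text \<open>Exponents are counted from \<open>J\<close> and not from \<open>j\<close>, so the same
  bound holds for every starting level \<open>j \<ge> J\<close>; leaves of different levels can thus
  share one \<open>M\<close>.\<close>

lemma telescoping_limit_bound:
  fixes P :: "nat \<Rightarrow> real"
  assumes lim: "P \<longlonglongrightarrow> s" and \<theta>: "0 \<le> \<theta>" "\<theta> < 1" and "J \<le> j" "0 \<le> M"
    and step: "\<And>i. j \<le> i \<Longrightarrow> \<bar>P (Suc i) - P i\<bar> \<le> M * \<theta> ^ (i - J)"
  shows "\<bar>s - P j\<bar> \<le> M / (1 - \<theta>)"
proof -
  have "\<bar>P n - P j\<bar> \<le> M / (1 - \<theta>)" if "j \<le> n" for n
  proof -
    have "\<bar>P n - P j\<bar> = \<bar>\<Sum>i\<in>{j..<n}. P (Suc i) - P i\<bar>"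
      using that by (simp add: sum_Suc_diff')
    also have "\<dots> \<le> (\<Sum>i\<in>{j..<n}. M * \<theta> ^ (i - J))"
      by (intro order_trans[OF sum_abs] sum_mono step) auto
    also have "\<dots> = M * (\<Sum>i\<in>{j..<n}. \<theta> ^ (i - J))" by (simp add: sum_distrib_left)
    also have "\<dots> \<le> M * (\<theta> ^ (j - J) / (1 - \<theta>))"
      using sum_geometric_le[OF \<theta> \<open>J \<le> j\<close>] \<open>0 \<le> M\<close> by (intro mult_left_mono)
    also have "\<dots> \<le> M * (1 / (1 - \<theta>))"
      using \<theta> \<open>0 \<le> M\<close> by (intro mult_left_mono divide_right_mono power_le_one) auto
    finally show ?thesis by simp
  qed
  then have "\<forall>\<^sub>F n in sequentially. \<bar>P n - P j\<bar> \<le> M / (1 - \<theta>)"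
    by (auto simp: eventually_sequentially)
  moreover have "(\<lambda>n. \<bar>P n - P j\<bar>) \<longlonglongrightarrow> \<bar>s - P j\<bar>" by (intro tendsto_intros lim)
  ultimately show ?thesis
    by (intro tendsto_upperbound[of _ _ sequentially]) auto
qed

text \<open>A substitute for Minkowski's inequality for infinite sums that works for every \<open>q > 0\<close>: from
  \<open>g k x \<le> B x * \<theta> ^ k\<close> with \<open>B x powr q = (\<Sum>k. (g k x / \<theta> ^ k) powr q)\<close>.\<close>

lemma nn_integral_powr_geometric_le:
  fixes g :: "nat \<Rightarrow> 'a \<Rightarrow> real"
  assumes [measurable]: "\<And>k. g k \<in> borel_measurable M" and g: "\<And>k x. 0 \<le> g k x"
    and q: "0 < q" and \<theta>: "0 < \<theta>" "\<theta> < 1" and c: "0 \<le> c"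
    and int: "\<And>k. (\<integral>\<^sup>+ x. ennreal (g k x powr q) \<partial>M) \<le> ennreal (c * (\<theta> powr q) ^ (2 * k))"
    and f: "AE x in M. \<forall>B\<ge>0. (\<forall>k. g k x \<le> B * \<theta> ^ k) \<longrightarrow> \<bar>f x\<bar> \<le> B / (1 - \<theta>)"
  shows "(\<integral>\<^sup>+ x. ennreal (\<bar>f x\<bar> powr q) \<partial>M) \<le> ennreal (c / ((1 - \<theta>) powr q * (1 - \<theta> powr q)))"
proof -
  \<comment> \<open>The integrals decay like \<open>(\<theta> powr q) ^ (2 * k)\<close>. Half of
    this decay is spent on the division, which produces the pointwise geometric bound; the other
    half keeps the integrals of the \<open>h k\<close> summable.\<close>
  define h where "h k x = g k x powr q / (\<theta> powr q) ^ k" for k x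
  have [measurable]: "h k \<in> borel_measurable M" for k unfolding h_def by measurable
  have tq: "0 < \<theta> powr q" "\<theta> powr q < 1"
    using \<theta> q powr_less_mono2[of q \<theta> 1] by auto
  have h0: "0 \<le> h k x" for k x by (simp add: h_def)
  define A where "A = 1 / (1 - \<theta>) powr q"
  have A: "0 < A" using \<theta> by (simp add: A_def)
  have inth: "(\<integral>\<^sup>+ x. ennreal (h k x) \<partial>M) \<le> ennreal (c * (\<theta> powr q) ^ k)" for k
  proof -
    have "(\<integral>\<^sup>+ x. ennreal (h k x) \<partial>M)
        = (\<integral>\<^sup>+ x. ennreal (1 / (\<theta> powr q) ^ k) * ennreal (g k x powr q) \<partial>M)"
      by (intro nn_integral_cong) (subst ennreal_mult[symmetric], auto simp: h_def)
    also have "\<dots> = ennreal (1 / (\<theta> powr q) ^ k) * (\<integral>\<^sup>+ x. ennreal (g k x powr q) \<partial>M)"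
      by (rule nn_integral_cmult) measurable
    also have "\<dots> \<le> ennreal (1 / (\<theta> powr q) ^ k) * ennreal (c * (\<theta> powr q) ^ (2 * k))"
      by (intro mult_left_mono int) auto
    also have "\<dots> = ennreal (1 / (\<theta> powr q) ^ k * (c * (\<theta> powr q) ^ (2 * k)))"
      using c by (intro ennreal_mult[symmetric]) auto
    also have "1 / (\<theta> powr q) ^ k * (c * (\<theta> powr q) ^ (2 * k)) = c * (\<theta> powr q) ^ k"
      using tq(1) by (simp add: mult_2 power_add)
    finally show ?thesis .
  qed
  have "AE x in M. ennreal (\<bar>f x\<bar> powr q) \<le> ennreal A * (\<Sum>k. ennreal (h k x))"
    using f
  proof eventually_elim
    case (elim x)
    show ?case
    proof (cases "(\<Sum>k. ennreal (h k x)) = \<infinity>")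
      case True
      then show ?thesis using A by (simp add: ennreal_mult_top)
    next
      case False
      then have sm: "summable (\<lambda>k. h k x)" by (intro summable_suminf_not_top h0) auto
      define S where "S = (\<Sum>k. h k x)"
      have S0: "0 \<le> S" unfolding S_def by (intro suminf_nonneg sm h0)
      have "g k x \<le> S powr (1 / q) * \<theta> ^ k" for k
      proof -
        have "h k x \<le> S" unfolding S_def
          using sum_le_suminf[OF sm, of "{k}"] h0 by simp
        then have "g k x powr q \<le> S * (\<theta> powr q) ^ k"
          using tq(1) by (simp add: h_def pos_divide_le_eq)
        also have "\<dots> = (S powr (1 / q) * \<theta> ^ k) powr q"
          using S0 q \<theta> by (simp add: powr_mult powr_powr powr_realpow[symmetric] mult.commute)
        finally have le: "g k x powr q \<le> (S powr (1 / q) * \<theta> ^ k) powr q" .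
        show ?thesis
        proof (rule ccontr)
          assume "\<not> g k x \<le> S powr (1 / q) * \<theta> ^ k"
          then have "(S powr (1 / q) * \<theta> ^ k) powr q < g k x powr q"
            using q \<theta> by (intro powr_less_mono2) auto
          with le show False by simp
        qed
      qed
      then have "\<bar>f x\<bar> \<le> S powr (1 / q) / (1 - \<theta>)" using elim by auto
      then have "\<bar>f x\<bar> powr q \<le> (S powr (1 / q) / (1 - \<theta>)) powr q"
        using q by (intro powr_mono2) auto
      also have "\<dots> = A * S"
        using S0 q \<theta> by (simp add: A_def powr_divide powr_powr)
      finally have "ennreal (\<bar>f x\<bar> powr q) \<le> ennreal (A * S)" by (rule ennreal_leI)
      also have "\<dots> = ennreal A * (\<Sum>k. ennreal (h k x))"
        using A S0 sm h0 by (simp add: ennreal_mult S_def suminf_ennreal2)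
      finally show ?thesis .
    qed
  qed
  then have "(\<integral>\<^sup>+ x. ennreal (\<bar>f x\<bar> powr q) \<partial>M) \<le> (\<integral>\<^sup>+ x. ennreal A * (\<Sum>k. ennreal (h k x)) \<partial>M)"
    by (rule nn_integral_mono_AE)
  also have "\<dots> = ennreal A * (\<Sum>k. \<integral>\<^sup>+ x. ennreal (h k x) \<partial>M)"
    by (subst nn_integral_cmult, measurable, subst nn_integral_suminf, measurable)
  also have "\<dots> \<le> ennreal A * (\<Sum>k. ennreal (c * (\<theta> powr q) ^ k))"
    by (intro mult_left_mono suminf_le inth) auto
  also have "(\<Sum>k. ennreal (c * (\<theta> powr q) ^ k)) = ennreal (c * (1 / (1 - \<theta> powr q)))"
    using tq c by (intro suminf_ennreal_eq sums_mult geometric_sums) auto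
  also have "ennreal A * \<dots> = ennreal (c / ((1 - \<theta>) powr q * (1 - \<theta> powr q)))"
    using A c tq by (subst ennreal_mult[symmetric]) (auto simp: A_def)
  finally show ?thesis .
qed

section \<open>Adaptive approximation\<close>

lemma partition_onD_unique:
  assumes "partition_on U m" "K \<in> m" "L \<in> m" "x \<in> K" "x \<in> L"
  shows "K = L"
  using assms by (auto simp: partition_on_def disjoint_def)

text \<open>Twice the maximum of the two distances bounds the third, which works for every
  \<open>p > 0\<close> and stands in for the triangle inequality in L_p.\<close>

lemma abs_diff_powr_le:
  fixes a b c :: real
  assumes "0 < p"
  shows "\<bar>a - b\<bar> powr p \<le> 2 powr p * (\<bar>c - a\<bar> powr p + \<bar>c - b\<bar> powr p)"
proof -
  define m where "m = max \<bar>c - a\<bar> \<bar>c - b\<bar>"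
  have "\<bar>c - a\<bar> \<le> m" "\<bar>c - b\<bar> \<le> m" by (auto simp: m_def)
  then have "\<bar>a - b\<bar> \<le> 2 * m" "0 \<le> m" by linarith+
  then have "\<bar>a - b\<bar> powr p \<le> (2 * m) powr p" using assms by (intro powr_mono2) auto
  also have "\<dots> = 2 powr p * m powr p" using \<open>0 \<le> m\<close> by (simp add: powr_mult)
  also have "\<dots> \<le> 2 powr p * (\<bar>c - a\<bar> powr p + \<bar>c - b\<bar> powr p)"
    by (intro mult_left_mono) (auto simp: m_def max_def)
  finally show ?thesis .
qed

lemma nn_integral_abs_diff_powr_le:
  assumes [measurable]: "f \<in> borel_measurable M" "g \<in> borel_measurable M" "s \<in> borel_measurable M"
    and "0 < p" "0 \<le> A"
    and "(\<integral>\<^sup>+ x. ennreal (\<bar>s x - f x\<bar> powr p) \<partial>M) \<le> ennreal A"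
    and "(\<integral>\<^sup>+ x. ennreal (\<bar>s x - g x\<bar> powr p) \<partial>M) \<le> ennreal A"
  shows "(\<integral>\<^sup>+ x. ennreal (\<bar>f x - g x\<bar> powr p) \<partial>M) \<le> ennreal (2 powr (p + 1) * A)"
proof -
  have "(\<integral>\<^sup>+ x. ennreal (\<bar>f x - g x\<bar> powr p) \<partial>M)
      \<le> (\<integral>\<^sup>+ x. ennreal (2 powr p) * (ennreal (\<bar>s x - f x\<bar> powr p) + ennreal (\<bar>s x - g x\<bar> powr p)) \<partial>M)"
  proof (rule nn_integral_mono)
    fix x
    have "ennreal (\<bar>f x - g x\<bar> powr p)
        \<le> ennreal (2 powr p * (\<bar>s x - f x\<bar> powr p + \<bar>s x - g x\<bar> powr p))"
      by (intro ennreal_leI abs_diff_powr_le assms)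
    then show "ennreal (\<bar>f x - g x\<bar> powr p)
        \<le> ennreal (2 powr p) * (ennreal (\<bar>s x - f x\<bar> powr p) + ennreal (\<bar>s x - g x\<bar> powr p))"
      by (simp add: ennreal_mult)
  qed
  also have "\<dots> = ennreal (2 powr p) * ((\<integral>\<^sup>+ x. ennreal (\<bar>s x - f x\<bar> powr p) \<partial>M)
      + (\<integral>\<^sup>+ x. ennreal (\<bar>s x - g x\<bar> powr p) \<partial>M))"
    by (subst nn_integral_cmult, measurable, subst nn_integral_add, measurable)
  also have "\<dots> \<le> ennreal (2 powr p) * (ennreal A + ennreal A)"
    by (intro mult_left_mono add_mono assms) auto
  also have "\<dots> = ennreal (2 powr (p + 1) * A)"
    using \<open>0 \<le> A\<close> by (simp add: ennreal_plus[symmetric] ennreal_mult[symmetric] powr_add del: ennreal_plus)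
  finally show ?thesis .
qed

text \<open>Markov's inequality on cells: \<open>G\<close> collects those whose integral exceeds
  \<open>W / N\<close>. They are disjoint and the total is at most \<open>W\<close>, so there are at
  most \<open>N\<close> of them. On any other cell, Nikolskii's inequality turns the small integral
  into a pointwise bound.\<close>

lemma greedy_cells:
  fixes r j :: "nat ^ 'd"
  assumes nik: "\<forall>K\<in>dyadic_rectangles_of j. \<forall>P\<in>coord_polys r. \<forall>Q. (\<forall>x\<in>K. Q x = P x) \<longrightarrow>
      (\<forall>x\<in>K. ennreal (\<bar>Q x\<bar> powr p) \<le> ennreal C *
        (\<integral>\<^sup>+ y. ennreal (\<bar>Q y\<bar> powr p) * indicator K y \<partial>cube_measure))"
    and Q: "Q \<in> piecewise_polys (dyadic_rectangles_of j) r"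
    and int: "(\<integral>\<^sup>+ x. ennreal (\<bar>Q x\<bar> powr p) \<partial>cube_measure) \<le> ennreal W"
    and pos: "0 < C" "0 < W" "0 < N"
  shows "\<exists>G\<subseteq>dyadic_rectangles_of j. real (card G) \<le> N \<and>
    (\<forall>x\<in>unit_cube. x \<notin> \<Union>G \<longrightarrow> \<bar>Q x\<bar> powr p \<le> C * (W / N))"
proof -
  let ?I = "\<lambda>K. \<integral>\<^sup>+ y. ennreal (\<bar>Q y\<bar> powr p) * indicator K y \<partial>cube_measure"
  define G where "G = {K \<in> dyadic_rectangles_of j. ennreal (W / N) < ?I K}"
  have finG: "finite G" unfolding G_def using finite_dyadic_rectangles_of[of j] by simp
  have [measurable]: "Q \<in> borel_measurable cube_measure"
    using Q by (rule piecewise_polys_dyadic_measurable)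
  have sub: "K \<subseteq> unit_cube" if "K \<in> G" for K
    using that partition_dyadic_rectangles_of[of j] by (auto simp: G_def partition_on_def)
  have setsK: "K \<in> sets cube_measure" if "K \<in> G" for K
    using that sub by (intro sets_cube_measure dyadic_rectangles_of_borel) (auto simp: G_def)
  have uniq: "K = L" if "K \<in> G" "L \<in> G" "x \<in> K" "x \<in> L" for K L x
    using partition_onD_unique[OF partition_dyadic_rectangles_of[of j]] that by (auto simp: G_def)
  have "ennreal (real (card G) * (W / N)) = ennreal (\<Sum>K\<in>G. W / N)" by simp
  also have "\<dots> = (\<Sum>K\<in>G. ennreal (W / N))"
    using pos by (intro sum_ennreal[symmetric]) auto
  also have "\<dots> \<le> (\<Sum>K\<in>G. ?I K)" by (intro sum_mono) (auto simp: G_def less_imp_le)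
  also have "\<dots> = (\<integral>\<^sup>+ y. (\<Sum>K\<in>G. ennreal (\<bar>Q y\<bar> powr p) * indicator K y) \<partial>cube_measure)"
  proof (rule nn_integral_sum[symmetric])
    fix K assume "K \<in> G"
    then have [measurable]: "K \<in> sets cube_measure" by (rule setsK)
    show "(\<lambda>y. ennreal (\<bar>Q y\<bar> powr p) * indicator K y) \<in> borel_measurable cube_measure"
      by measurable
  qed
  also have "\<dots> \<le> (\<integral>\<^sup>+ y. ennreal (\<bar>Q y\<bar> powr p) \<partial>cube_measure)"
  proof (rule nn_integral_mono)
    fix y
    show "(\<Sum>K\<in>G. ennreal (\<bar>Q y\<bar> powr p) * indicator K y) \<le> ennreal (\<bar>Q y\<bar> powr p)"
    proof (cases "\<exists>K\<in>G. y \<in> K")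
      case True
      then obtain K where K: "K \<in> G" "y \<in> K" by blast
      have "ennreal (\<bar>Q y\<bar> powr p) * indicator L y = (if L = K then ennreal (\<bar>Q y\<bar> powr p) else 0)"
        if L: "L \<in> G" for L
      proof (cases "L = K")
        case False
        then have "y \<notin> L" using uniq K L by blast
        with False show ?thesis by simp
      qed (use K in simp)
      then have "(\<Sum>L\<in>G. ennreal (\<bar>Q y\<bar> powr p) * indicator L y)
          = (\<Sum>L\<in>G. if L = K then ennreal (\<bar>Q y\<bar> powr p) else 0)"
        by (rule sum.cong[OF refl])
      then show ?thesis using K finG by simp
    next
      case False
      then have "(\<Sum>K\<in>G. ennreal (\<bar>Q y\<bar> powr p) * indicator K y) = 0"
        by (intro sum.neutral) auto
      then show ?thesis by simp
    qed
  qed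
  also have "\<dots> \<le> ennreal W" by (rule int)
  finally have "real (card G) * (W / N) \<le> W" using pos by (simp add: ennreal_le_iff)
  then have "real (card G) \<le> N" using pos by (simp add: field_simps)
  moreover have "\<bar>Q x\<bar> powr p \<le> C * (W / N)" if x: "x \<in> unit_cube" "x \<notin> \<Union>G" for x
  proof -
    have "unit_cube = \<Union>(dyadic_rectangles_of j)"
      using partition_dyadic_rectangles_of[of j] by (simp add: partition_on_def)
    then obtain K where K: "K \<in> dyadic_rectangles_of j" "x \<in> K" using x(1) by blast
    then have "K \<notin> G" using x(2) by blast
    then have I: "?I K \<le> ennreal (W / N)" using K(1) by (simp add: G_def not_less)
    obtain P where P: "P \<in> coord_polys r" "\<forall>x\<in>K. Q x = P x"
      using Q K(1) by (auto simp: piecewise_polys_def)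
    have "ennreal (\<bar>Q x\<bar> powr p) \<le> ennreal C * ?I K"
      using nik K P by blast
    also have "\<dots> \<le> ennreal C * ennreal (W / N)" by (intro mult_left_mono I) auto
    also have "\<dots> = ennreal (C * (W / N))" using pos by (intro ennreal_mult[symmetric]) auto
    finally show ?thesis using pos by (simp add: ennreal_le_iff)
  qed
  moreover have "G \<subseteq> dyadic_rectangles_of j" by (auto simp: G_def)
  ultimately show ?thesis by blast
qed

lemma piecewise_polys_diff:
  assumes "f \<in> piecewise_polys m r" "g \<in> piecewise_polys m r"
  shows "(\<lambda>x. f x - g x) \<in> piecewise_polys m r"
  unfolding piecewise_polys_def
proof (intro CollectI ballI)
  fix K assume K: "K \<in> m"
  obtain P where P: "P \<in> coord_polys r" "\<forall>x\<in>K. f x = P x"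
    using assms(1) K unfolding piecewise_polys_def by blast
  obtain Q where Q: "Q \<in> coord_polys r" "\<forall>x\<in>K. g x = Q x"
    using assms(2) K unfolding piecewise_polys_def by blast
  show "\<exists>R\<in>coord_polys r. \<forall>x\<in>K. f x - g x = R x"
    by (rule bexI[OF _ coord_polys_diff[OF P(1) Q(1)]]) (simp add: P(2) Q(2))
qed

section \<open>The partition adapted to the heavy cells\<close>

text \<open>\<open>B\<close> measures the L_p error on level \<open>J\<close>, and decay is demanded
  from that level on. The predicate serves as the common hypothesis of the cases
  \<open>q \<le> p\<close> and \<open>p < q\<close>.\<close>

definition level_approximation ::
  "nat ^ 'd \<Rightarrow> (nat \<Rightarrow> nat ^ 'd) \<Rightarrow> real \<Rightarrow> real \<Rightarrow> nat \<Rightarrow> real \<Rightarrow>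
    (real ^ 'd \<Rightarrow> real) \<Rightarrow> (nat \<Rightarrow> real ^ 'd \<Rightarrow> real) \<Rightarrow> bool" where
  "level_approximation r L p \<mu> J B s P \<longleftrightarrow>
    0 < B \<and> s \<in> borel_measurable cube_measure \<and>
    (\<forall>i. P i \<in> piecewise_polys (dyadic_rectangles_of (L i)) r) \<and>
    (\<forall>k. (\<integral>\<^sup>+ x. ennreal (\<bar>s x - P (J + k) x\<bar> powr p) \<partial>cube_measure)
        \<le> ennreal ((B * 2 powr (- (real k * \<mu>))) powr p))"

text \<open>The last clause is how the functions \<open>g k\<close> control \<open>f\<close>: it holds if \<open>\<bar>f\<bar> \<le> (\<Sum>k. g k)\<close> almost everywhere.\<close>

definition layer_bound ::
  "real \<Rightarrow> real \<Rightarrow> real \<Rightarrow> real \<Rightarrow> real \<Rightarrow> (nat \<Rightarrow> real ^ 'd \<Rightarrow> real) \<Rightarrow> (real ^ 'd \<Rightarrow> real) \<Rightarrow> bool" where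
  "layer_bound c p \<mu> \<gamma> B g f \<longleftrightarrow>
    (\<forall>k. g k \<in> borel_measurable cube_measure) \<and> (\<forall>k x. 0 \<le> g k x) \<and>
    (\<forall>k. \<forall>x\<in>unit_cube. g k x powr p \<le> c * B powr p * 2 powr (real k * \<gamma>)) \<and>
    (\<forall>k. (\<integral>\<^sup>+ x. ennreal (g k x powr p) \<partial>cube_measure)
      \<le> ennreal (c * B powr p * 2 powr (- (real k * \<mu> * p)))) \<and>
    (AE x in cube_measure. \<forall>M \<theta>. 0 \<le> M \<longrightarrow> 0 \<le> \<theta> \<longrightarrow> \<theta> < 1 \<longrightarrow> (\<forall>k. g k x \<le> M * \<theta> ^ k) \<longrightarrow>
      \<bar>f x\<bar> \<le> M / (1 - \<theta>))"

definition small_dyadic_partition :: "real \<Rightarrow> (real ^ 'd) set set \<Rightarrow> bool" where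
  "small_dyadic_partition N m \<longleftrightarrow>
    partition_on unit_cube m \<and> finite m \<and> m \<subseteq> dyadic_rectangles \<and> real (card m) \<le> N"

text \<open>The constant is fixed before \<open>J\<close>, \<open>s\<close>, \<open>P\<close> and
  \<open>B\<close>, so that it can enter the final one. Making heavy cells rarer by the factor
  \<open>2 powr (- \<epsilon>)\<close> from one level to the next costs the summand
  \<open>\<epsilon>\<close> in the growth exponent of the layers.\<close>

lemma adaptive_partition:
  fixes r :: "nat ^ 'd" and L :: "nat \<Rightarrow> nat ^ 'd" and p \<mu> \<beta> \<epsilon> :: real
  assumes p: "0 < p" and pos: "0 < \<mu>" "0 < \<beta>" "0 < \<epsilon>"
    and Lmono: "\<And>i j l. i \<le> j \<Longrightarrow> L i $ l \<le> L j $ l"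
    and Lstep: "\<And>j. (\<Sum>l\<in>UNIV. L (Suc j) $ l) \<le> (\<Sum>l\<in>UNIV. L j $ l) + n"
    and Lle: "\<And>j. real (\<Sum>l\<in>UNIV. L j $ l) \<le> real j * \<beta>"
  shows "\<exists>c>0. \<forall>J s P B. level_approximation r L p \<mu> J B s P \<longrightarrow>
    (\<exists>m t g. small_dyadic_partition (2 * 2 powr (real J * \<beta>)) m \<and> t \<in> piecewise_polys m r \<and>
      layer_bound c p \<mu> (\<beta> + \<epsilon> - \<mu> * p) B g (\<lambda>x. s x - t x))"
proof -
  obtain C where C: "0 < C" and nik: "\<forall>j. \<forall>K\<in>dyadic_rectangles_of j. \<forall>P\<in>coord_polys r. \<forall>Q. (\<forall>x\<in>K. Q x = P x) \<longrightarrow>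
    (\<forall>x\<in>K. ennreal (\<bar>Q x\<bar> powr p) \<le> ennreal (C * 2 ^ (\<Sum>l\<in>UNIV. j $ l)) *
        (\<integral>\<^sup>+ y. ennreal (\<bar>Q y\<bar> powr p) * indicator K y \<partial>cube_measure))"
    using dyadic_nikolskii[OF p, of r] by blast
  define \<rho> :: real where "\<rho> = 2 powr (- \<epsilon>)"
  have \<rho>: "0 < \<rho>" "\<rho> < 1" using pos(3) by (auto simp: \<rho>_def powr_less_one)
  \<comment> \<open>Chosen to cancel the factor \<open>2 ^ n / (1 - \<rho>)\<^sup>2\<close> from
    \<open>stopping_partition\<close>: refining adds at most \<open>2 powr (J * \<beta>)\<close>
    cells, the same amount that bounds the starting grid.\<close>
  define \<eta> where "\<eta> = (1 - \<rho>)\<^sup>2 / 2 ^ n"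
  have \<eta>: "0 < \<eta>" using \<rho> by (simp add: \<eta>_def)
  \<comment> \<open>\<open>2 powr \<beta>\<close> pays for using Nikolskii on level
    \<open>Suc (J + k)\<close>, \<open>2 powr (p + 1)\<close> for passing from the errors of two
    approximations to their difference, and \<open>1 / \<eta>\<close> for the restricted number of
    heavy cells.\<close>
  define c1 where "c1 = C * 2 powr \<beta> * 2 powr (p + 1) / \<eta>"
  define c where "c = c1 + 2 powr (p + 1)"
  have c1: "0 < c1" using C \<eta> by (simp add: c1_def)
  have c: "0 < c" "c1 \<le> c" "2 powr (p + 1) \<le> c" using c1 by (auto simp: c_def intro: add_pos_pos)
  show ?thesis
  proof (intro exI[of _ c] conjI c(1) allI impI)
    fix J and s :: "real ^ 'd \<Rightarrow> real" and P and B :: real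
    assume "level_approximation r L p \<mu> J B s P"
    then have B: "0 < B" and s [measurable]: "s \<in> borel_measurable cube_measure"
      and P: "\<forall>i. P i \<in> piecewise_polys (dyadic_rectangles_of (L i)) r"
      and int: "\<forall>k. (\<integral>\<^sup>+ x. ennreal (\<bar>s x - P (J + k) x\<bar> powr p) \<partial>cube_measure)
        \<le> ennreal ((B * 2 powr (- (real k * \<mu>))) powr p)"
      unfolding level_approximation_def by simp_all
    have Pm [measurable]: "P i \<in> borel_measurable cube_measure" for i
      using P piecewise_polys_dyadic_measurable by blast
    define Q where "Q i x = P (Suc i) x - P i x" for i x
    have Qm [measurable]: "Q i \<in> borel_measurable cube_measure" for i unfolding Q_def by measurable
    define W where "W k = 2 powr (p + 1) * (B * 2 powr (- (real k * \<mu>))) powr p" for k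
    define N where "N k = \<eta> * 2 powr (real J * \<beta>) * \<rho> ^ k" for k
    have Wpos: "0 < W k" and Npos: "0 < N k" for k using B \<eta> \<rho> by (auto simp: W_def N_def)
    have intQ: "(\<integral>\<^sup>+ x. ennreal (\<bar>Q (J + k) x\<bar> powr p) \<partial>cube_measure) \<le> ennreal (W k)" for k
      unfolding Q_def W_def
    proof (rule nn_integral_abs_diff_powr_le[OF Pm Pm s p])
      \<comment> \<open>The error bound decreases with the level, so the one of level
        \<open>J + k\<close> serves for both terms of the difference.\<close>
      have "(B * 2 powr (- (real (Suc k) * \<mu>))) powr p \<le> (B * 2 powr (- (real k * \<mu>))) powr p"
        using B p pos(1) by (intro powr_mono2 mult_left_mono powr_mono) (auto simp: algebra_simps)
      then show "(\<integral>\<^sup>+ x. ennreal (\<bar>s x - P (Suc (J + k)) x\<bar> powr p) \<partial>cube_measure)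
          \<le> ennreal ((B * 2 powr (- (real k * \<mu>))) powr p)"
        using int[rule_format, of "Suc k"] by (auto intro: order_trans ennreal_leI)
    qed (use int in auto)
    have Qp: "Q i \<in> piecewise_polys (dyadic_rectangles_of (L (Suc i))) r" for i
      unfolding Q_def
    proof (rule piecewise_polys_diff)
      have "\<forall>K'\<in>dyadic_rectangles_of (L (Suc i)). \<exists>K\<in>dyadic_rectangles_of (L i). K' \<subseteq> K"
        using dyadic_rectangles_of_coarsen[OF Lmono[of i "Suc i"]] by simp
      then show "P i \<in> piecewise_polys (dyadic_rectangles_of (L (Suc i))) r"
        using P piecewise_polys_refine by blast
    qed (use P in auto)
    have "\<exists>G\<subseteq>dyadic_rectangles_of (L (Suc (J + k))). real (card G) \<le> N k \<and>
        (\<forall>x\<in>unit_cube. x \<notin> \<Union>G \<longrightarrow>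
          \<bar>Q (J + k) x\<bar> powr p \<le> C * 2 ^ (\<Sum>l\<in>UNIV. L (Suc (J + k)) $ l) * (W k / N k))" for k
      using nik[rule_format, of _ "L (Suc (J + k))"] C
      by (intro greedy_cells[OF _ Qp intQ _ Wpos Npos]) auto
    then obtain G0 where G0: "\<And>k. G0 k \<subseteq> dyadic_rectangles_of (L (Suc (J + k)))"
        "\<And>k. real (card (G0 k)) \<le> N k"
        "\<And>k x. x \<in> unit_cube \<Longrightarrow> x \<notin> \<Union>(G0 k) \<Longrightarrow>
          \<bar>Q (J + k) x\<bar> powr p \<le> C * 2 ^ (\<Sum>l\<in>UNIV. L (Suc (J + k)) $ l) * (W k / N k)"
      by metis
    \<comment> \<open>The inverse cell volume and the number \<open>N k\<close> both carry
      \<open>2 powr (J * \<beta>)\<close>; it cancels, and \<open>J\<close> survives only through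
      \<open>B\<close>.\<close>
    have V: "C * 2 ^ (\<Sum>l\<in>UNIV. L (Suc (J + k)) $ l) * (W k / N k)
        \<le> c1 * B powr p * 2 powr (real k * (\<beta> + \<epsilon> - \<mu> * p))" for k
    proof -
      have "(2::real) ^ (\<Sum>l\<in>UNIV. L (Suc (J + k)) $ l) = 2 powr real (\<Sum>l\<in>UNIV. L (Suc (J + k)) $ l)"
        by (rule powr_realpow[symmetric]) simp
      also have "\<dots> \<le> 2 powr (real (Suc (J + k)) * \<beta>)" by (intro powr_mono Lle) auto
      also have "\<dots> = 2 powr (real J * \<beta>) * 2 powr (real k * \<beta>) * 2 powr \<beta>"
        by (simp add: powr_add[symmetric] algebra_simps)
      finally have le: "(2::real) ^ (\<Sum>l\<in>UNIV. L (Suc (J + k)) $ l)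
          \<le> 2 powr (real J * \<beta>) * 2 powr (real k * \<beta>) * 2 powr \<beta>" .
      have Wk: "W k = 2 powr (p + 1) * B powr p * 2 powr (- (real k * \<mu> * p))"
        using B by (simp add: W_def powr_mult powr_powr)
      have \<rho>k: "\<rho> ^ k = 2 powr (- (real k * \<epsilon>))"
        by (simp add: \<rho>_def powr_realpow[symmetric] powr_powr mult.commute)
      have e: "2 powr (real k * (\<beta> + \<epsilon> - \<mu> * p))
          = 2 powr (real k * \<beta>) * 2 powr (- (real k * \<mu> * p)) / 2 powr (- (real k * \<epsilon>))"
        by (simp add: powr_add[symmetric] powr_diff[symmetric] algebra_simps)
      have "C * 2 ^ (\<Sum>l\<in>UNIV. L (Suc (J + k)) $ l) * (W k / N k)
          \<le> C * (2 powr (real J * \<beta>) * 2 powr (real k * \<beta>) * 2 powr \<beta>) * (W k / N k)"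
        using C Wpos[of k] Npos[of k] le by (intro mult_right_mono mult_left_mono) auto
      also have "\<dots> = c1 * B powr p * 2 powr (real k * (\<beta> + \<epsilon> - \<mu> * p))"
        unfolding e Wk N_def \<rho>k c1_def using \<eta> by (simp add: field_simps)
      finally show ?thesis .
    qed
    \<comment> \<open>\<open>G0\<close> is indexed by the layer \<open>k\<close>, \<open>G\<close>
      by the level \<open>i = J + k\<close>; below \<open>J\<close> the empty family is the
      default.\<close>
    define G where "G i = (if i < J then {} else G0 (i - J))" for i
    obtain m lev where m: "partition_on unit_cube m" "finite m"
      and lev: "\<And>K. K \<in> m \<Longrightarrow> J \<le> lev K \<and> K \<in> dyadic_rectangles_of (L (lev K))"
      and G: "\<And>K K' i. K \<in> m \<Longrightarrow> lev K \<le> i \<Longrightarrow> K' \<in> G i \<Longrightarrow> \<not> K' \<subseteq> K"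
      and card: "real (card m) \<le> real (card (dyadic_rectangles_of (L J)))
        + real (2 ^ n) * (\<eta> * 2 powr (real J * \<beta>)) / (1 - \<rho>)\<^sup>2"
    proof (rule stopping_partition[of unit_cube "\<lambda>j. dyadic_rectangles_of (L j)" "2 ^ n" G J
          "\<eta> * 2 powr (real J * \<beta>)" \<rho>])
      show "\<exists>K'\<in>dyadic_rectangles_of (L i). K \<subseteq> K'"
        if "i \<le> j" "K \<in> dyadic_rectangles_of (L j)" for i j K
        using Lmono[OF that(1)] that(2) by (rule dyadic_rectangles_of_coarsen)
      show "card {K' \<in> dyadic_rectangles_of (L (Suc j)). K' \<subseteq> K} \<le> 2 ^ n"
        if "K \<in> dyadic_rectangles_of (L j)" for j K
        using that Lstep by (rule card_dyadic_rectangles_of_children)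
      show "G i \<subseteq> dyadic_rectangles_of (L (Suc i))" for i
        using G0(1)[of "i - J"] by (auto simp: G_def)
      show "real (card (G i)) \<le> \<eta> * 2 powr (real J * \<beta>) * \<rho> ^ (i - J)" if "J \<le> i" for i
        using G0(2)[of "i - J"] that by (simp add: G_def N_def)
    qed (use \<rho> \<eta> partition_dyadic_rectangles_of finite_dyadic_rectangles_of in auto)
    have "real (card (dyadic_rectangles_of (L J))) \<le> 2 ^ (\<Sum>l\<in>UNIV. L J $ l)"
      by (rule card_dyadic_rectangles_of_le)
    also have "\<dots> = 2 powr real (\<Sum>l\<in>UNIV. L J $ l)" by (rule powr_realpow[symmetric]) simp
    also have "\<dots> \<le> 2 powr (real J * \<beta>)" by (intro powr_mono Lle) auto
    finally have cardm: "real (card m) \<le> 2 * 2 powr (real J * \<beta>)"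
      using card \<rho> by (simp add: \<eta>_def)
    \<comment> \<open>Erasing heavy cells does not affect \<open>s - t\<close>: from its own level
      on a leaf contains no heavy cell, and differences of earlier levels do not occur in
      \<open>s - t\<close> on that leaf.\<close>
    define g where "g k x = (if x \<in> \<Union>(G0 k) then 0 else \<bar>Q (J + k) x\<bar>)" for k x
    define t where "t x = P (lev (THE K. K \<in> m \<and> x \<in> K)) x" for x
    have the: "(THE K. K \<in> m \<and> x \<in> K) = K" if "K \<in> m" "x \<in> K" for K x
    proof (rule the_equality)
      show "K \<in> m \<and> x \<in> K" using that by simp
      show "K' = K" if "K' \<in> m \<and> x \<in> K'" for K'
        using that partition_onD_unique[OF m(1) _ \<open>K \<in> m\<close> _ \<open>x \<in> K\<close>] by blast
    qed
    have tp: "t \<in> piecewise_polys m r"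
      unfolding piecewise_polys_def
    proof (intro CollectI ballI)
      fix K assume K: "K \<in> m"
      obtain R where "R \<in> coord_polys r" "\<forall>x\<in>K. P (lev K) x = R x"
        using P lev[OF K] unfolding piecewise_polys_def by blast
      moreover have "t x = P (lev K) x" if "x \<in> K" for x
        unfolding t_def using the[OF K that] by simp
      ultimately show "\<exists>R\<in>coord_polys r. \<forall>x\<in>K. t x = R x" by auto
    qed
    have G0sets [measurable]: "\<Union>(G0 k) \<in> sets cube_measure" for k
    proof (rule sets_cube_measure)
      have "finite (G0 k)" using G0(1) finite_dyadic_rectangles_of finite_subset by blast
      then show "\<Union>(G0 k) \<in> sets borel"
        using G0(1) dyadic_rectangles_of_borel by (intro sets.finite_Union) blast+
      show "\<Union>(G0 k) \<subseteq> unit_cube"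
        using G0(1)[of k] partition_dyadic_rectangles_of[of "L (Suc (J + k))"]
        unfolding partition_on_def by blast
    qed
    have gm: "g k \<in> borel_measurable cube_measure" for k unfolding g_def by measurable
    have g0: "0 \<le> g k x" for k x by (simp add: g_def)
    have gV: "g k x powr p \<le> c * B powr p * 2 powr (real k * (\<beta> + \<epsilon> - \<mu> * p))"
      if x: "x \<in> unit_cube" for k x
    proof -
      have "g k x powr p \<le> c1 * B powr p * 2 powr (real k * (\<beta> + \<epsilon> - \<mu> * p))"
      proof (cases "x \<in> \<Union>(G0 k)")
        case True
        then show ?thesis using c1 by (simp add: g_def)
      next
        case False
        then show ?thesis using order_trans[OF G0(3)[OF x False] V] by (simp add: g_def)
      qed
      also have "\<dots> \<le> c * B powr p * 2 powr (real k * (\<beta> + \<epsilon> - \<mu> * p))"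
        using c(2) by (intro mult_right_mono) auto
      finally show ?thesis .
    qed
    have gint: "(\<integral>\<^sup>+ x. ennreal (g k x powr p) \<partial>cube_measure)
        \<le> ennreal (c * B powr p * 2 powr (- (real k * \<mu> * p)))" for k
    proof -
      have "(\<integral>\<^sup>+ x. ennreal (g k x powr p) \<partial>cube_measure)
          \<le> (\<integral>\<^sup>+ x. ennreal (\<bar>Q (J + k) x\<bar> powr p) \<partial>cube_measure)"
        by (intro nn_integral_mono ennreal_leI) (simp add: g_def)
      also have "\<dots> \<le> ennreal (W k)" by (rule intQ)
      also have "W k = 2 powr (p + 1) * B powr p * 2 powr (- (real k * \<mu> * p))"
        using B by (simp add: W_def powr_mult powr_powr)
      also have "ennreal \<dots> \<le> ennreal (c * B powr p * 2 powr (- (real k * \<mu> * p)))"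
        using c(3) by (intro ennreal_leI mult_right_mono) auto
      finally show ?thesis .
    qed
    have "AE x in cube_measure. (\<lambda>k. s x - P (J + k) x) \<longlonglongrightarrow> 0"
    proof (rule AE_tendsto_zero_of_geometric_integrals[where p = p and c = "B powr p" and a = "2 powr (- (\<mu> * p))"])
      show "(\<integral>\<^sup>+ x. ennreal (\<bar>s x - P (J + k) x\<bar> powr p) \<partial>cube_measure)
          \<le> ennreal (B powr p * (2 powr (- (\<mu> * p))) ^ k)" for k
        using int[rule_format, of k] B
        by (simp add: powr_mult powr_powr powr_realpow[symmetric] mult_ac)
    qed (use p pos in \<open>auto simp: powr_less_one\<close>)
    then have AE: "AE x in cube_measure. \<forall>M \<theta>. 0 \<le> M \<longrightarrow> 0 \<le> \<theta> \<longrightarrow> \<theta> < 1 \<longrightarrow>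
        (\<forall>k. g k x \<le> M * \<theta> ^ k) \<longrightarrow> \<bar>s x - t x\<bar> \<le> M / (1 - \<theta>)"
    proof (rule AE_mp, intro AE_I2 impI allI)
      fix x M \<theta> assume x: "x \<in> space cube_measure" and lim0: "(\<lambda>k. s x - P (J + k) x) \<longlonglongrightarrow> 0"
        and M: "0 \<le> M" and \<theta>: "0 \<le> \<theta>" "\<theta> < 1" and gle: "\<forall>k. g k x \<le> M * \<theta> ^ k"
      have "(\<lambda>k. s x - (s x - P (k + J) x)) \<longlonglongrightarrow> s x - 0"
        using lim0 by (intro tendsto_diff tendsto_const) (simp add: add.commute)
      then have "(\<lambda>k. P (k + J) x) \<longlonglongrightarrow> s x" by simp
      then have lim: "(\<lambda>i. P i x) \<longlonglongrightarrow> s x" by (rule LIMSEQ_offset)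
      obtain K where K: "K \<in> m" "x \<in> K" using x m(1) by (auto simp: partition_on_def)
      have "\<bar>s x - P (lev K) x\<bar> \<le> M / (1 - \<theta>)"
      proof (rule telescoping_limit_bound[OF lim \<theta> _ M])
        show "J \<le> lev K" using lev[OF K(1)] by simp
        fix i assume i: "lev K \<le> i"
        then have Ji: "J \<le> i" using lev[OF K(1)] by simp
        \<comment> \<open>A heavy cell through \<open>x\<close> is finer than the leaf
          \<open>K\<close>, hence inside \<open>K\<close> by nestedness, which the stopping rule
          excludes.\<close>
        have "x \<notin> \<Union>(G0 (i - J))"
        proof
          assume "x \<in> \<Union>(G0 (i - J))"
          then obtain K' where K': "K' \<in> G0 (i - J)" "x \<in> K'" by blast
          then have "K' \<in> dyadic_rectangles_of (L (Suc i))" using G0(1)[of "i - J"] Ji by auto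
          moreover have "\<And>l. L (lev K) $ l \<le> L (Suc i) $ l" using Lmono i by simp
          ultimately obtain K'' where K'': "K'' \<in> dyadic_rectangles_of (L (lev K))" "K' \<subseteq> K''"
            using dyadic_rectangles_of_coarsen by blast
          then have "K'' = K"
            using partition_onD_unique[OF partition_dyadic_rectangles_of] K K' lev[OF K(1)] by blast
          then show False using G[OF K(1) i, of K'] K' K'' Ji by (simp add: G_def)
        qed
        then have "\<bar>P (Suc i) x - P i x\<bar> = g (i - J) x" using Ji by (simp add: g_def Q_def)
        then show "\<bar>P (Suc i) x - P i x\<bar> \<le> M * \<theta> ^ (i - J)" using gle by simp
      qed
      then show "\<bar>s x - t x\<bar> \<le> M / (1 - \<theta>)" unfolding t_def using the[OF K] by simp
    qed
    have "m \<subseteq> dyadic_rectangles" using lev by (auto simp: dyadic_rectangles_def)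
    then have "small_dyadic_partition (2 * 2 powr (real J * \<beta>)) m"
      using m cardm by (simp add: small_dyadic_partition_def)
    moreover have "layer_bound c p \<mu> (\<beta> + \<epsilon> - \<mu> * p) B g (\<lambda>x. s x - t x)"
      unfolding layer_bound_def using gm g0 gV gint AE by blast
    ultimately show "\<exists>m t g. small_dyadic_partition (2 * 2 powr (real J * \<beta>)) m \<and> t \<in> piecewise_polys m r \<and>
      layer_bound c p \<mu> (\<beta> + \<epsilon> - \<mu> * p) B g (\<lambda>x. s x - t x)"
      using tp by blast
  qed
qed

section \<open>From layers to L_q norms\<close>

text \<open>Splitting at \<open>\<bar>f x\<bar> \<le> B\<close> replaces Hoelder's inequality: where
  \<open>\<bar>f x\<bar>\<close> is larger, its power with the nonpositive exponent
  \<open>q - p\<close> is at most that of \<open>B\<close>. Since the cube has measure 1, the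
  integral is at most \<open>2 * B powr q\<close>, and \<open>q \<ge> 1\<close> moves the 2 inside
  the power.\<close>

lemma Lp_norm_le_of_larger_exponent:
  fixes f :: "real ^ 'd \<Rightarrow> real"
  assumes [measurable]: "f \<in> borel_measurable cube_measure" and q: "1 \<le> q" "q \<le> p" and B: "0 < B"
    and int: "(\<integral>\<^sup>+ x. ennreal (\<bar>f x\<bar> powr p) \<partial>cube_measure) \<le> ennreal (B powr p)"
  shows "Lp_norm (ennreal q) f \<le> ennreal (2 * B)"
proof -
  have pt: "\<bar>f x\<bar> powr q \<le> B powr q + B powr (q - p) * \<bar>f x\<bar> powr p" for x
  proof (cases "\<bar>f x\<bar> \<le> B")
    case True
    then have "\<bar>f x\<bar> powr q \<le> B powr q" using q by (intro powr_mono2) auto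
    then show ?thesis by (simp add: add_increasing2)
  next
    case False
    then have "\<bar>f x\<bar> powr q = \<bar>f x\<bar> powr (q - p) * \<bar>f x\<bar> powr p"
      by (simp add: powr_add[symmetric])
    also have "\<dots> \<le> B powr (q - p) * \<bar>f x\<bar> powr p"
      using False q B by (intro mult_right_mono powr_mono2') auto
    finally show ?thesis by (simp add: add_increasing)
  qed
  have "(\<integral>\<^sup>+ x. ennreal (\<bar>f x\<bar> powr q) \<partial>cube_measure)
      \<le> (\<integral>\<^sup>+ x. ennreal (B powr q) + ennreal (B powr (q - p)) * ennreal (\<bar>f x\<bar> powr p) \<partial>cube_measure)"
    using pt by (intro nn_integral_mono) (simp add: ennreal_mult[symmetric] ennreal_plus[symmetric] del: ennreal_plus)
  also have "\<dots> = ennreal (B powr q) + ennreal (B powr (q - p)) * (\<integral>\<^sup>+ x. ennreal (\<bar>f x\<bar> powr p) \<partial>cube_measure)"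
  proof -
    have "(\<integral>\<^sup>+ x. ennreal (B powr q) + ennreal (B powr (q - p)) * ennreal (\<bar>f x\<bar> powr p) \<partial>cube_measure)
        = (\<integral>\<^sup>+ (x :: real ^ 'd). ennreal (B powr q) \<partial>cube_measure)
          + (\<integral>\<^sup>+ x. ennreal (B powr (q - p)) * ennreal (\<bar>f x\<bar> powr p) \<partial>cube_measure)"
      by (rule nn_integral_add) measurable
    also have "(\<integral>\<^sup>+ (x :: real ^ 'd). ennreal (B powr q) \<partial>cube_measure) = ennreal (B powr q)"
      by (simp only: nn_integral_const space_cube_measure emeasure_cube_measure mult_1_right)
    also have "(\<integral>\<^sup>+ x. ennreal (B powr (q - p)) * ennreal (\<bar>f x\<bar> powr p) \<partial>cube_measure)
        = ennreal (B powr (q - p)) * (\<integral>\<^sup>+ x. ennreal (\<bar>f x\<bar> powr p) \<partial>cube_measure)"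
      by (rule nn_integral_cmult) measurable
    finally show ?thesis .
  qed
  also have "\<dots> \<le> ennreal (B powr q) + ennreal (B powr (q - p)) * ennreal (B powr p)"
    by (intro add_left_mono mult_left_mono int) auto
  also have "\<dots> = ennreal (2 * B powr q)"
    using B by (simp add: ennreal_mult[symmetric] powr_add[symmetric] ennreal_plus[symmetric] del: ennreal_plus)
  also have "\<dots> \<le> ennreal ((2 * B) powr q)"
  proof (intro ennreal_leI)
    have "(2::real) powr 1 \<le> 2 powr q" using q by (intro powr_mono) auto
    then show "2 * B powr q \<le> (2 * B) powr q" using B by (simp add: powr_mult)
  qed
  finally show ?thesis using q B by (subst Lp_norm_le_iff) auto
qed

text \<open>Interpolation between the pointwise and the integral bound of each layer. Assumption
  \<open>crit\<close> says that the resulting L_q bounds decay geometrically in the layer, with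
  \<open>\<gamma> + \<mu> * p\<close> in the role of \<open>\<beta> + \<epsilon>\<close>.\<close>

lemma layer_bound_Lp_norm_le:
  fixes p c \<mu> \<gamma> :: real and q :: ennreal
  assumes p: "0 < p" and c: "0 < c" and q: "ennreal p < q"
    and crit: "(1 / p - enn2real (1 / q)) * (\<gamma> + \<mu> * p) < \<mu>"
  shows "\<exists>c'>0. \<forall>B (f :: real ^ 'd \<Rightarrow> real) g. 0 < B \<longrightarrow> f \<in> borel_measurable cube_measure \<longrightarrow>
    layer_bound c p \<mu> \<gamma> B g f \<longrightarrow> Lp_norm q f \<le> ennreal (c' * B)"
proof -
  define \<delta> where "\<delta> = 1 / p - enn2real (1 / q)"
  \<comment> \<open>Layer \<open>k\<close> will have L_q norm at most a constant times
    \<open>B * 2 powr (k * \<kappa>)\<close>. For infinite \<open>q\<close> this exponent reduces to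
    \<open>\<gamma> / p\<close>.\<close>
  define \<kappa> where "\<kappa> = \<delta> * (\<gamma> + \<mu> * p) - \<mu>"
  have \<kappa>: "\<kappa> < 0" using crit by (simp add: \<kappa>_def \<delta>_def)
  show ?thesis
  proof (cases q)
    case top
    then have \<delta>p: "\<delta> = 1 / p" by (simp add: \<delta>_def)
    define \<theta> :: real where "\<theta> = 2 powr \<kappa>"
    have \<theta>: "0 \<le> \<theta>" "\<theta> < 1" using \<kappa> by (auto simp: \<theta>_def powr_less_one)
    show ?thesis
    proof (intro exI[of _ "c powr (1 / p) / (1 - \<theta>)"] conjI allI impI)
      show "0 < c powr (1 / p) / (1 - \<theta>)" using c \<theta> by simp
      fix B :: real and f :: "real ^ 'd \<Rightarrow> real" and g
      assume B: "0 < B" and [measurable]: "f \<in> borel_measurable cube_measure"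
        and "layer_bound c p \<mu> \<gamma> B g f"
      then have g0: "\<forall>k x. (0::real) \<le> g k x"
        and gV: "\<forall>k. \<forall>x\<in>unit_cube. g k x powr p \<le> c * B powr p * 2 powr (real k * \<gamma>)"
        and AE: "AE x in cube_measure. \<forall>M \<theta>. 0 \<le> M \<longrightarrow> 0 \<le> \<theta> \<longrightarrow> \<theta> < 1 \<longrightarrow> (\<forall>k. g k x \<le> M * \<theta> ^ k) \<longrightarrow>
          \<bar>f x\<bar> \<le> M / (1 - \<theta>)"
        unfolding layer_bound_def by blast+
      have gle: "g k x \<le> c powr (1 / p) * B * \<theta> ^ k" if x: "x \<in> unit_cube" for k x
      proof -
        have "\<gamma> * (1 / p) = \<kappa>"
          using p by (simp add: \<kappa>_def \<delta>p field_simps)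
        then have e: "real k * \<gamma> * (1 / p) = real k * \<kappa>" by (simp only: mult.assoc)
        have "g k x = (g k x powr p) powr (1 / p)" using g0 p by (simp add: powr_powr)
        also have "\<dots> \<le> (c * B powr p * 2 powr (real k * \<gamma>)) powr (1 / p)"
          using gV x p by (intro powr_mono2) auto
        also have "\<dots> = c powr (1 / p) * B * 2 powr (real k * \<gamma> * (1 / p))"
          using c B p by (simp add: powr_mult powr_powr)
        also have "\<dots> = c powr (1 / p) * B * \<theta> ^ k"
          unfolding e by (simp add: \<theta>_def powr_realpow[symmetric] powr_powr mult.commute)
        finally show ?thesis .
      qed
      have "AE x in cube_measure. ennreal \<bar>f x\<bar> \<le> ennreal (c powr (1 / p) / (1 - \<theta>) * B)"
        using AE
      proof (rule AE_mp, intro AE_I2 impI ennreal_leI)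
        fix x assume x: "x \<in> space cube_measure" and *: "\<forall>M \<theta>. 0 \<le> M \<longrightarrow> 0 \<le> \<theta> \<longrightarrow> \<theta> < 1 \<longrightarrow>
            (\<forall>k. g k x \<le> M * \<theta> ^ k) \<longrightarrow> \<bar>f x\<bar> \<le> M / (1 - \<theta>)"
        have "\<bar>f x\<bar> \<le> c powr (1 / p) * B / (1 - \<theta>)"
          using *[rule_format, of "c powr (1 / p) * B" \<theta>] \<theta> c B gle x by simp
        then show "\<bar>f x\<bar> \<le> c powr (1 / p) / (1 - \<theta>) * B" by simp
      qed
      then have "esssup cube_measure (\<lambda>x. ennreal \<bar>f x\<bar>) \<le> ennreal (c powr (1 / p) / (1 - \<theta>) * B)"
        by (intro esssup_I) measurable
      then show "Lp_norm q f \<le> ennreal (c powr (1 / p) / (1 - \<theta>) * B)"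
        using top by (simp add: Lp_norm_def)
    qed
  next
    case (real q')
    then have q': "p < q'" using q p by (simp add: ennreal_less_iff)
    then have "1 / q = ennreal (1 / q')" using real p
      by (simp add: divide_ennreal[symmetric])
    then have "enn2real (1 / q) = 1 / q'" using q' p by simp
    then have \<delta>q: "\<delta> = 1 / p - 1 / q'" by (simp add: \<delta>_def)
    \<comment> \<open>With this exponent \<open>g powr q' = (g powr p) powr e * g powr p\<close>;
      the pointwise bound is applied to the first factor and the integral bound to the
      second.\<close>
    define e where "e = (q' - p) / p"
    have e: "0 < e" using q' p by (simp add: e_def)
    \<comment> \<open>Half the rate \<open>\<kappa>\<close>, because
      \<open>nn_integral_powr_geometric_le\<close> consumes integrals of order
      \<open>(\<theta> powr q') ^ (2 * k)\<close>. For infinite \<open>q\<close> the layers are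
      summed pointwise and the full rate is available.\<close>
    define \<theta> :: real where "\<theta> = 2 powr (\<kappa> / 2)"
    have \<theta>: "0 < \<theta>" "\<theta> < 1" using \<kappa> by (auto simp: \<theta>_def powr_less_one)
    have \<theta>q: "\<theta> powr q' < 1" using \<theta> q' p powr_less_mono2[of q' \<theta> 1] by simp
    define A where "A = c powr (e + 1) / ((1 - \<theta>) powr q' * (1 - \<theta> powr q'))"
    have A: "0 < A" using c \<theta> \<theta>q by (simp add: A_def)
    show ?thesis
    proof (intro exI[of _ "A powr (1 / q')"] conjI allI impI)
      show "0 < A powr (1 / q')" using A by simp
      fix B :: real and f :: "real ^ 'd \<Rightarrow> real" and g
      assume B: "0 < B" and [measurable]: "f \<in> borel_measurable cube_measure"
        and "layer_bound c p \<mu> \<gamma> B g f"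
      then have gm: "\<forall>k. g k \<in> borel_measurable cube_measure"
        and g0: "\<forall>k x. (0::real) \<le> g k x"
        and gV: "\<forall>k. \<forall>x\<in>unit_cube. g k x powr p \<le> c * B powr p * 2 powr (real k * \<gamma>)"
        and gint: "\<forall>k. (\<integral>\<^sup>+ x. ennreal (g k x powr p) \<partial>cube_measure)
          \<le> ennreal (c * B powr p * 2 powr (- (real k * \<mu> * p)))"
        and AE: "AE x in cube_measure. \<forall>M \<theta>. 0 \<le> M \<longrightarrow> 0 \<le> \<theta> \<longrightarrow> \<theta> < 1 \<longrightarrow> (\<forall>k. g k x \<le> M * \<theta> ^ k) \<longrightarrow>
          \<bar>f x\<bar> \<le> M / (1 - \<theta>)"
        unfolding layer_bound_def by blast+
      have gm' [measurable]: "g k \<in> borel_measurable cube_measure" for k using gm by blast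
      have gq: "(\<integral>\<^sup>+ x. ennreal (g k x powr q') \<partial>cube_measure)
          \<le> ennreal (c powr (e + 1) * B powr q' * (\<theta> powr q') ^ (2 * k))" for k
      proof -
        let ?V = "c * B powr p * 2 powr (real k * \<gamma>)"
        have "(\<integral>\<^sup>+ x. ennreal (g k x powr q') \<partial>cube_measure)
            \<le> (\<integral>\<^sup>+ x. ennreal (?V powr e) * ennreal (g k x powr p) \<partial>cube_measure)"
        proof (rule nn_integral_mono)
          fix x :: "real ^ 'd" assume "x \<in> space cube_measure"
          then have "(g k x powr p) powr e \<le> ?V powr e"
            using gV e by (intro powr_mono2) auto
          moreover have "g k x powr q' = (g k x powr p) powr e * g k x powr p"
            using p by (simp add: powr_powr powr_add[symmetric] e_def)
          ultimately have "g k x powr q' \<le> ?V powr e * g k x powr p"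
            by (simp add: mult_right_mono)
          then show "ennreal (g k x powr q') \<le> ennreal (?V powr e) * ennreal (g k x powr p)"
            by (simp add: ennreal_mult[symmetric] ennreal_leI)
        qed
        also have "\<dots> = ennreal (?V powr e) * (\<integral>\<^sup>+ x. ennreal (g k x powr p) \<partial>cube_measure)"
          by (rule nn_integral_cmult) measurable
        also have "\<dots> \<le> ennreal (?V powr e) * ennreal (c * B powr p * 2 powr (- (real k * \<mu> * p)))"
          using gint by (intro mult_left_mono) auto
        also have "\<dots> = ennreal (?V powr e * (c * B powr p * 2 powr (- (real k * \<mu> * p))))"
          using c by (intro ennreal_mult[symmetric]) auto
        also have "?V powr e * (c * B powr p * 2 powr (- (real k * \<mu> * p)))
            = c powr (e + 1) * B powr q' * (\<theta> powr q') ^ (2 * k)"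
        proof -
          have "p * e + p = q'" using p by (simp add: e_def)
          then have Bq: "B powr q' = (B powr p) powr e * B powr p"
            using B by (simp add: powr_powr powr_add[symmetric])
          have ed: "e = q' * \<delta>" using p q' by (simp add: e_def \<delta>q field_simps)
          have "\<gamma> * e - \<mu> * p = e * (\<gamma> + \<mu> * p) - \<mu> * (p * e + p)"
            by (simp add: algebra_simps)
          also have "\<dots> = q' * (\<delta> * (\<gamma> + \<mu> * p) - \<mu>)"
            unfolding \<open>p * e + p = q'\<close> by (simp add: ed algebra_simps)
          finally have h: "\<gamma> * e - \<mu> * p = q' * \<kappa>" by (simp only: \<kappa>_def)
          have "real k * \<gamma> * e + - (real k * \<mu> * p)
              = real k * (\<gamma> * e - \<mu> * p)"
            by (simp add: algebra_simps)
          then have ex: "real k * \<gamma> * e + - (real k * \<mu> * p) = real k * (q' * \<kappa>)"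
            by (simp only: h)
          have "?V powr e = c powr e * (B powr p) powr e * 2 powr (real k * \<gamma> * e)"
            using c by (simp add: powr_mult powr_powr)
          then have "?V powr e * (c * B powr p * 2 powr (- (real k * \<mu> * p)))
            = (c powr e * c) * ((B powr p) powr e * B powr p) *
              (2 powr (real k * \<gamma> * e) * 2 powr (- (real k * \<mu> * p)))"
            by (simp only: mult_ac)
          also have "\<dots> = c powr (e + 1) * B powr q' * 2 powr (real k * (q' * \<kappa>))"
            unfolding powr_add[symmetric] ex Bq[symmetric] using c by (simp add: powr_add)
          also have "2 powr (real k * (q' * \<kappa>)) = (\<theta> powr q') ^ (2 * k)"
            by (simp add: \<theta>_def powr_realpow[symmetric] powr_powr mult_ac)
          finally show ?thesis .
        qed
        finally show ?thesis .
      qed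
      have "(\<integral>\<^sup>+ x. ennreal (\<bar>f x\<bar> powr q') \<partial>cube_measure)
          \<le> ennreal (c powr (e + 1) * B powr q' / ((1 - \<theta>) powr q' * (1 - \<theta> powr q')))"
      proof (rule nn_integral_powr_geometric_le[OF gm' _ _ \<theta> _ gq])
        show "AE x in cube_measure. \<forall>M\<ge>0. (\<forall>k. g k x \<le> M * \<theta> ^ k) \<longrightarrow> \<bar>f x\<bar> \<le> M / (1 - \<theta>)"
          using AE by eventually_elim (use \<theta> in auto)
      qed (use g0 q' p in auto)
      also have "c powr (e + 1) * B powr q' / ((1 - \<theta>) powr q' * (1 - \<theta> powr q')) = A * B powr q'"
        by (simp add: A_def)
      also have "A * B powr q' = (A powr (1 / q') * B) powr q'"
        using A B q' p by (simp add: powr_mult powr_powr)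
      finally show "Lp_norm q f \<le> ennreal (A powr (1 / q') * B)"
        using A B q' p real by (simp add: Lp_norm_le_iff)
    qed
  qed
qed

lemma adaptive_approx:
  fixes r :: "nat ^ 'd" and L :: "nat \<Rightarrow> nat ^ 'd" and p \<mu> \<beta> :: real and q :: ennreal
  assumes p: "0 < p" and pos: "0 < \<mu>" "0 < \<beta>"
    and Lmono: "\<And>i j l. i \<le> j \<Longrightarrow> L i $ l \<le> L j $ l"
    and Lstep: "\<And>j. (\<Sum>l\<in>UNIV. L (Suc j) $ l) \<le> (\<Sum>l\<in>UNIV. L j $ l) + n"
    and Lle: "\<And>j. real (\<Sum>l\<in>UNIV. L j $ l) \<le> real j * \<beta>"
    and q: "ennreal p < q" "(1 / p - enn2real (1 / q)) * \<beta> < \<mu>"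
  shows "\<exists>c>0. \<forall>J s P B. level_approximation r L p \<mu> J B s P \<longrightarrow>
    (\<exists>m t. small_dyadic_partition (2 * 2 powr (real J * \<beta>)) m \<and> t \<in> piecewise_polys m r \<and>
      Lp_norm q (\<lambda>x. s x - t x) \<le> ennreal (c * B))"
proof -
  define \<delta> where "\<delta> = 1 / p - enn2real (1 / q)"
  have \<delta>: "0 < \<delta>"
  proof (cases q)
    case (real q')
    then have q': "p < q'" using q(1) p by (simp add: ennreal_less_iff)
    then have "1 / q = ennreal (1 / q')" using real p
      by (simp add: divide_ennreal[symmetric])
    then have "enn2real (1 / q) = 1 / q'" using q' p by simp
    then show ?thesis using q' p by (simp add: \<delta>_def frac_less2)
  qed (use p in \<open>simp add: \<delta>_def\<close>)
  \<comment> \<open>This puts \<open>\<delta> * (\<beta> + \<epsilon>)\<close> halfway between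
    \<open>\<delta> * \<beta>\<close> and \<open>\<mu>\<close>; it is positive by the strict
    inequality in the assumption on \<open>q\<close>.\<close>
  define \<epsilon> where "\<epsilon> = (\<mu> - \<delta> * \<beta>) / (2 * \<delta>)"
  have \<epsilon>: "0 < \<epsilon>" using q(2) \<delta> by (simp add: \<epsilon>_def \<delta>_def)
  have "\<delta> * (\<beta> + \<epsilon>) = (\<delta> * \<beta> + \<mu>) / 2"
    using \<delta> by (simp add: \<epsilon>_def field_simps)
  then have crit: "(1 / p - enn2real (1 / q)) * (\<beta> + \<epsilon> - \<mu> * p + \<mu> * p) < \<mu>"
    using q(2) by (simp add: \<delta>_def)
  obtain c where c: "0 < c" and part: "\<forall>J s P B. level_approximation r L p \<mu> J B s P \<longrightarrow>
    (\<exists>m t g. small_dyadic_partition (2 * 2 powr (real J * \<beta>)) m \<and> t \<in> piecewise_polys m r \<and>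
      layer_bound c p \<mu> (\<beta> + \<epsilon> - \<mu> * p) B g (\<lambda>x. s x - t x))"
    using adaptive_partition[OF p pos \<epsilon> Lmono Lstep Lle, of r] by blast
  obtain c' where c': "0 < c'" and bd: "\<forall>B (f :: real ^ 'd \<Rightarrow> real) g. 0 < B \<longrightarrow>
      f \<in> borel_measurable cube_measure \<longrightarrow> layer_bound c p \<mu> (\<beta> + \<epsilon> - \<mu> * p) B g f \<longrightarrow>
      Lp_norm q f \<le> ennreal (c' * B)"
    using layer_bound_Lp_norm_le[OF p c q(1) crit] by blast
  show ?thesis
  proof (intro exI[of _ c'] conjI c' allI impI)
    fix J s P and B :: real
    assume hyp: "level_approximation r L p \<mu> J B s P"
    then have B: "0 < B" and s [measurable]: "s \<in> borel_measurable cube_measure"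
      by (simp_all add: level_approximation_def)
    obtain m t g where m: "small_dyadic_partition (2 * 2 powr (real J * \<beta>)) m"
        and t: "t \<in> piecewise_polys m r"
        and g: "layer_bound c p \<mu> (\<beta> + \<epsilon> - \<mu> * p) B g (\<lambda>x. s x - t x)"
      using part hyp by blast
    have m': "m \<subseteq> dyadic_rectangles" "partition_on unit_cube m" "finite m"
      using m by (auto simp: small_dyadic_partition_def)
    have "m \<subseteq> sets borel"
      using m'(1) dyadic_rectangles_of_borel by (auto simp: dyadic_rectangles_def)
    then have [measurable]: "t \<in> borel_measurable cube_measure"
      using t m' by (intro piecewise_polys_measurable)
    have "Lp_norm q (\<lambda>x. s x - t x) \<le> ennreal (c' * B)"
      by (rule bd[rule_format, OF B _ g]) measurable
    then show "\<exists>m t. small_dyadic_partition (2 * 2 powr (real J * \<beta>)) m \<and> t \<in> piecewise_polys m r \<and>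
      Lp_norm q (\<lambda>x. s x - t x) \<le> ennreal (c' * B)"
      using m t by blast
  qed
qed

text \<open>On a space of measure 1 the L_p error on level \<open>J\<close> controls the L_q error
  for \<open>q \<le> p\<close>, so \<open>P J\<close> itself is the approximant. The slack factor 2
  in the cell count matches the adaptive case.\<close>

lemma uniform_approx:
  fixes r :: "nat ^ 'd" and L :: "nat \<Rightarrow> nat ^ 'd" and p \<mu> \<beta> B :: real and q :: ennreal
  assumes q: "1 \<le> q" "q \<le> ennreal p"
    and Lle: "real (\<Sum>l\<in>UNIV. L J $ l) \<le> real J * \<beta>"
    and approx: "level_approximation r L p \<mu> J B s P"
  shows "\<exists>m t. small_dyadic_partition (2 * 2 powr (real J * \<beta>)) m \<and> t \<in> piecewise_polys m r \<and>
      Lp_norm q (\<lambda>x. s x - t x) \<le> ennreal (2 * B)"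
proof -
  have B: "0 < B" and [measurable]: "s \<in> borel_measurable cube_measure"
    and t: "P J \<in> piecewise_polys (dyadic_rectangles_of (L J)) r"
    using approx by (simp_all add: level_approximation_def)
  have "(\<integral>\<^sup>+ x. ennreal (\<bar>s x - P (J + 0) x\<bar> powr p) \<partial>cube_measure)
      \<le> ennreal ((B * 2 powr (- (real 0 * \<mu>))) powr p)"
    using approx unfolding level_approximation_def by blast
  then have int: "(\<integral>\<^sup>+ x. ennreal (\<bar>s x - P J x\<bar> powr p) \<partial>cube_measure) \<le> ennreal (B powr p)"
    by simp
  obtain q' where q': "q = ennreal q'" "0 \<le> q'" using q(2) by (cases q) (auto simp: top_unique)
  have "1 \<le> q'" using q(1) q' by simp
  have "q' \<le> p"
    using q(2) \<open>1 \<le> q'\<close> q' by (simp add: ennreal_le_iff2)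
  have [measurable]: "P J \<in> borel_measurable cube_measure"
    using t by (rule piecewise_polys_dyadic_measurable)
  have "Lp_norm q (\<lambda>x. s x - P J x) \<le> ennreal (2 * B)"
    unfolding q' by (rule Lp_norm_le_of_larger_exponent[OF _ \<open>1 \<le> q'\<close> \<open>q' \<le> p\<close> B int]) measurable
  moreover have "real (card (dyadic_rectangles_of (L J))) \<le> 2 * 2 powr (real J * \<beta>)"
  proof -
    have "real (card (dyadic_rectangles_of (L J))) \<le> 2 ^ (\<Sum>l\<in>UNIV. L J $ l)"
      by (rule card_dyadic_rectangles_of_le)
    also have "\<dots> = 2 powr real (\<Sum>l\<in>UNIV. L J $ l)" by (rule powr_realpow[symmetric]) simp
    also have "\<dots> \<le> 2 powr (real J * \<beta>)" by (intro powr_mono Lle) auto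
    finally show ?thesis by (smt (verit) powr_ge_zero)
  qed
  ultimately show ?thesis
    using t partition_dyadic_rectangles_of finite_dyadic_rectangles_of
    by (intro exI[of _ "dyadic_rectangles_of (L J)"] exI[of _ "P J"])
      (auto simp: dyadic_rectangles_def small_dyadic_partition_def)
qed

section \<open>Smoothness classes\<close>

text \<open>A single term of a sequence is at most its supremum and at most its p-summation
  quasi-norm.\<close>

lemma smoothness_class_approx_error_le:
  assumes s: "s \<in> smoothness_class r \<sigma> (ennreal p) p' R" and p: "0 < p" and R: "0 \<le> R"
    and p': "p' = \<infinity> \<or> p' = ennreal p"
  shows "approx_error r \<sigma> (ennreal p) k s \<le> ennreal (R * 2 powr (- (real k * min_smoothness \<sigma>)))"
proof -
  let ?e = "approx_error r \<sigma> (ennreal p) k s" and ?w = "2 powr (real k * min_smoothness \<sigma>)"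
  define a where "a k = ennreal (2 powr (real k * min_smoothness \<sigma>)) * approx_error r \<sigma> (ennreal p) k s" for k
  have norm: "approx_seminorm r \<sigma> (ennreal p) p' s \<le> ennreal R"
    using s by (simp add: smoothness_class_def)
  have "a k \<le> ennreal R"
  proof (cases "p' = \<infinity>")
    case True
    have "a k \<le> (SUP k. a k)" by (rule SUP_upper) simp
    also have "\<dots> \<le> ennreal R"
      using norm True by (simp add: approx_seminorm_def a_def)
    finally show ?thesis .
  next
    case False
    then have "p' = ennreal p" using p' by simp
    then have "enn_powr (\<Sum>k. enn_powr (a k) p) (1 / p) \<le> ennreal R"
      using norm p by (simp add: approx_seminorm_def a_def)
    then have "(\<Sum>k. enn_powr (a k) p) \<le> ennreal (R powr p)"
      using p R by (simp only: enn_powr_le_iff)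
    moreover have "enn_powr (a k) p \<le> (\<Sum>k. enn_powr (a k) p)"
      using sum_le_suminf[of "\<lambda>k. enn_powr (a k) p" "{k}"] by simp
    ultimately have "enn_powr (a k) p \<le> ennreal (R powr p)" by (rule order_trans[rotated])
    then show ?thesis
      using enn_powr_le_iff[of "1 / p" "R powr p" "a k"] p R by (simp add: powr_powr)
  qed
  moreover have "?e = ennreal (1 / ?w) * a k"
    by (simp add: a_def mult.assoc[symmetric] ennreal_mult[symmetric])
  ultimately have "?e \<le> ennreal (1 / ?w) * ennreal R"
    by (metis mult_left_mono zero_le)
  also have "\<dots> = ennreal (R * 2 powr (- (real k * min_smoothness \<sigma>)))"
    using R by (simp add: ennreal_mult[symmetric] powr_minus_divide)
  finally show ?thesis .
qed

text \<open>The infimum need not be attained; since \<open>R\<close> is positive, doubling the bound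
  makes it strict and yields a competitor below it.\<close>

lemma smoothness_class_near_best:
  assumes s: "s \<in> smoothness_class r \<sigma> (ennreal p) p' R" and p: "0 < p" and R: "0 < R"
    and p': "p' = \<infinity> \<or> p' = ennreal p"
  shows "\<exists>P\<in>piecewise_polys (dyadic_rectangles_of (aniso_level \<sigma> k)) r.
    (\<integral>\<^sup>+ x. ennreal (\<bar>s x - P x\<bar> powr p) \<partial>cube_measure)
      \<le> ennreal ((2 * R * 2 powr (- (real k * min_smoothness \<sigma>))) powr p)"
proof -
  have "approx_error r \<sigma> (ennreal p) k s \<le> ennreal (R * 2 powr (- (real k * min_smoothness \<sigma>)))"
    using s p R p' by (intro smoothness_class_approx_error_le) auto
  also have "\<dots> < ennreal (2 * R * 2 powr (- (real k * min_smoothness \<sigma>)))"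
    using R by (intro ennreal_lessI) auto
  finally obtain P where P: "P \<in> piecewise_polys (dyadic_rectangles_of (aniso_level \<sigma> k)) r"
      "Lp_norm (ennreal p) (\<lambda>x. s x - P x) < ennreal (2 * R * 2 powr (- (real k * min_smoothness \<sigma>)))"
    unfolding approx_error_def INF_less_iff aniso_dyadic_def by blast
  have "(\<integral>\<^sup>+ x. ennreal (\<bar>s x - P x\<bar> powr p) \<partial>cube_measure)
      \<le> ennreal ((2 * R * 2 powr (- (real k * min_smoothness \<sigma>))) powr p)"
    using P(2) p R by (subst Lp_norm_le_iff[symmetric]) auto
  with P(1) show ?thesis by blast
qed

section \<open>Cell counts of the anisotropic grids\<close>

lemma min_smoothness_le: "min_smoothness \<sigma> \<le> \<sigma> $ l"
  unfolding min_smoothness_def by (rule Min_le) auto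

lemma min_smoothness_pos: "\<forall>l. 0 < \<sigma> $ l \<Longrightarrow> 0 < min_smoothness \<sigma>"
  unfolding min_smoothness_def by (subst Min_gr_iff) auto

lemma aniso_level_mono:
  assumes "\<forall>l. 0 < \<sigma> $ l" "i \<le> j"
  shows "aniso_level \<sigma> i $ l \<le> aniso_level \<sigma> j $ l"
proof -
  have "real i * min_smoothness \<sigma> / \<sigma> $ l \<le> real j * min_smoothness \<sigma> / \<sigma> $ l"
    using assms min_smoothness_pos[OF assms(1)]
    by (intro divide_right_mono mult_right_mono) (auto simp: less_imp_le)
  then show ?thesis unfolding aniso_level_def by (simp add: nat_mono floor_mono)
qed

text \<open>The least smoothness is at most \<open>\<sigma> $ l\<close>, so the number under each
  floor grows by at most one per level. Each side is halved at most once, and a cell has at most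
  \<open>2 ^ CARD('d)\<close> children.\<close>

lemma aniso_level_Suc_sum:
  fixes \<sigma> :: "real ^ 'd"
  assumes "\<forall>l. 0 < \<sigma> $ l"
  shows "(\<Sum>l\<in>UNIV. aniso_level \<sigma> (Suc j) $ l) \<le> (\<Sum>l\<in>UNIV. aniso_level \<sigma> j $ l) + CARD('d)"
proof -
  have "aniso_level \<sigma> (Suc j) $ l \<le> aniso_level \<sigma> j $ l + 1" for l
  proof -
    have "min_smoothness \<sigma> / \<sigma> $ l \<le> 1" using min_smoothness_le[of \<sigma> l] assms by simp
    then have "real (Suc j) * min_smoothness \<sigma> / \<sigma> $ l \<le> real j * min_smoothness \<sigma> / \<sigma> $ l + 1"
      by (simp add: distrib_right add_divide_distrib)
    then have "\<lfloor>real (Suc j) * min_smoothness \<sigma> / \<sigma> $ l\<rfloor> \<le> \<lfloor>real j * min_smoothness \<sigma> / \<sigma> $ l\<rfloor> + 1"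
      by linarith
    then show ?thesis unfolding aniso_level_def by simp
  qed
  then have "(\<Sum>l\<in>UNIV. aniso_level \<sigma> (Suc j) $ l) \<le> (\<Sum>l\<in>UNIV. aniso_level \<sigma> j $ l + 1)"
    by (rule sum_mono)
  then show ?thesis unfolding sum.distrib by simp
qed

text \<open>Dropping the floors bounds the binary logarithm of the number of cells linearly in the
  level; the coefficient is the growth rate \<open>\<beta>\<close> of the grids.\<close>

lemma aniso_level_sum_le:
  fixes \<sigma> :: "real ^ 'd"
  assumes "\<forall>l. 0 < \<sigma> $ l"
  shows "real (\<Sum>l\<in>UNIV. aniso_level \<sigma> j $ l) \<le> real j * (min_smoothness \<sigma> * (\<Sum>l\<in>UNIV. 1 / \<sigma> $ l))"
proof -
  have "real (aniso_level \<sigma> j $ l) \<le> real j * min_smoothness \<sigma> / \<sigma> $ l" for l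
  proof -
    have "0 \<le> real j * min_smoothness \<sigma> / \<sigma> $ l"
      using assms min_smoothness_pos[OF assms] by (simp add: less_imp_le)
    then show ?thesis unfolding aniso_level_def by simp
  qed
  then have "(\<Sum>l\<in>UNIV. real (aniso_level \<sigma> j $ l)) \<le> (\<Sum>l\<in>UNIV. real j * min_smoothness \<sigma> / \<sigma> $ l)"
    by (rule sum_mono)
  then show ?thesis by (simp add: sum_distrib_left)
qed

text \<open>The first constant is 2: then \<open>D / 2 \<ge> 1\<close>, so some level
  \<open>J \<ge> 0\<close> satisfies \<open>2 * 2 powr (J * \<beta>) \<le> D\<close>. The order of
  the quantifiers expresses the dependence of constants: the first precedes \<open>r\<close> and
  \<open>q\<close>, the second follows them but precedes \<open>R\<close> and
  \<open>D\<close>.\<close>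

theorem corollary1:
  fixes \<sigma> :: "real ^ 'd" and p :: real
  assumes "\<forall>l. 0 < \<sigma> $ l" and "0 < p"
  shows "\<exists>C\<^sub>1>0. \<forall>(r :: nat ^ 'd) (q :: ennreal) (p' :: ennreal).
    (\<forall>l. \<sigma> $ l < real (r $ l) + 1) \<longrightarrow> 1 \<le> q \<longrightarrow>
    harmonic_mean \<sigma> / real CARD('d) > max (1 / p - enn2real (1 / q)) 0 \<longrightarrow>
    p' = (if p \<le> 1 \<or> ennreal p \<ge> q then \<infinity> else ennreal p) \<longrightarrow>
    (\<exists>C\<^sub>2>0. \<forall>R>0. \<forall>D :: nat. real D \<ge> C\<^sub>1 \<longrightarrow>
      (SUP s \<in> smoothness_class r \<sigma> (ennreal p) p' R.
        INF t \<in> (\<Union>m \<in> dyadic_partitions D. piecewise_polys m r). Lp_norm q (\<lambda>x. s x - t x))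
      \<le> ennreal (C\<^sub>2 * R * real D powr (- (harmonic_mean \<sigma> / real CARD('d)))))"
proof (rule exI[of _ "2 :: real"], intro conjI allI impI)
  fix r :: "nat ^ 'd" and q p' :: ennreal
  assume q: "1 \<le> q" and crit: "harmonic_mean \<sigma> / real CARD('d) > max (1 / p - enn2real (1 / q)) 0"
    and p'_eq: "p' = (if p \<le> 1 \<or> ennreal p \<ge> q then \<infinity> else ennreal p)"
  define \<mu> where "\<mu> = min_smoothness \<sigma>"
  define \<beta> where "\<beta> = \<mu> * (\<Sum>l\<in>UNIV. 1 / \<sigma> $ l)"
  define L where "L = aniso_level \<sigma>"
  have \<mu>: "0 < \<mu>" unfolding \<mu>_def by (rule min_smoothness_pos[OF assms(1)])
  have S: "0 < (\<Sum>l\<in>UNIV. 1 / \<sigma> $ l)" using assms(1) by (intro sum_pos) auto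
  then have \<beta>: "0 < \<beta>" using \<mu> by (simp add: \<beta>_def)
  have H: "harmonic_mean \<sigma> / real CARD('d) = \<mu> / \<beta>"
    using \<mu> S by (simp add: harmonic_mean_def \<beta>_def field_simps)
  have p': "p' = \<infinity> \<or> p' = ennreal p" using p'_eq by auto
  have Lmono: "L i $ l \<le> L j $ l" if "i \<le> j" for i j l
    unfolding L_def using assms(1) that by (rule aniso_level_mono)
  have Lstep: "(\<Sum>l\<in>UNIV. L (Suc j) $ l) \<le> (\<Sum>l\<in>UNIV. L j $ l) + CARD('d)" for j
    unfolding L_def by (rule aniso_level_Suc_sum[OF assms(1)])
  have Lle: "real (\<Sum>l\<in>UNIV. L j $ l) \<le> real j * \<beta>" for j
    unfolding L_def \<beta>_def \<mu>_def by (rule aniso_level_sum_le[OF assms(1)])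
  have "\<exists>c>0. \<forall>J s P B. level_approximation r L p \<mu> J B s P \<longrightarrow>
    (\<exists>m t. small_dyadic_partition (2 * 2 powr (real J * \<beta>)) m \<and> t \<in> piecewise_polys m r \<and>
      Lp_norm q (\<lambda>x. s x - t x) \<le> ennreal (c * B))"
  proof (cases "q \<le> ennreal p")
    case True
    show ?thesis
      by (intro exI[of _ 2] conjI allI impI uniform_approx[where L = L and p = p, OF q True Lle]) auto
  next
    case False
    have "(1 / p - enn2real (1 / q)) * \<beta> < \<mu>"
      using crit \<beta> unfolding H by (simp add: pos_less_divide_eq)
    then show ?thesis
      using False by (intro adaptive_approx[OF assms(2) \<mu> \<beta> Lmono Lstep Lle]) auto
  qed
  then obtain c where c: "0 < c" and approx: "\<forall>J s P B. level_approximation r L p \<mu> J B s P \<longrightarrow>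
    (\<exists>m t. small_dyadic_partition (2 * 2 powr (real J * \<beta>)) m \<and> t \<in> piecewise_polys m r \<and>
      Lp_norm q (\<lambda>x. s x - t x) \<le> ennreal (c * B))"
    by blast
  \<comment> \<open>The factor 2 is lost to near-best approximation, \<open>2 powr \<mu>\<close> to
    rounding \<open>J\<close> down, and \<open>2 powr (\<mu> / \<beta>)\<close> to having
    \<open>D / 2\<close> in place of \<open>D\<close>.\<close>
  define C where "C = c * 2 * (2 powr \<mu> * 2 powr (\<mu> / \<beta>))"
  show "\<exists>C\<^sub>2>0. \<forall>R>0. \<forall>D :: nat. real D \<ge> 2 \<longrightarrow>
      (SUP s \<in> smoothness_class r \<sigma> (ennreal p) p' R.
        INF t \<in> (\<Union>m \<in> dyadic_partitions D. piecewise_polys m r). Lp_norm q (\<lambda>x. s x - t x))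
      \<le> ennreal (C\<^sub>2 * R * real D powr (- (harmonic_mean \<sigma> / real CARD('d))))"
  proof (intro exI[of _ C] conjI allI impI SUP_least)
    show "0 < C" using c by (simp add: C_def)
    fix R :: real and D :: nat and s
    assume R: "0 < R" and D: "2 \<le> real D" and s: "s \<in> smoothness_class r \<sigma> (ennreal p) p' R"
    \<comment> \<open>The finest level for which the guaranteed number of cells,
      \<open>2 * 2 powr (J * \<beta>)\<close>, is still at most \<open>D\<close>.\<close>
    define J where "J = nat \<lfloor>log 2 (real D / 2) / \<beta>\<rfloor>"
    have "0 \<le> log 2 (real D / 2) / \<beta>" using D \<beta> by simp
    then have J: "real J \<le> log 2 (real D / 2) / \<beta>" "log 2 (real D / 2) / \<beta> < real J + 1"
      unfolding J_def by linarith+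
    have "real J * \<beta> \<le> log 2 (real D / 2)" using J(1) \<beta> by (simp add: pos_le_divide_eq)
    then have "2 powr (real J * \<beta>) \<le> 2 powr log 2 (real D / 2)" by (intro powr_mono) auto
    then have JD: "2 * 2 powr (real J * \<beta>) \<le> real D" using D by simp
    have rate: "2 powr (- (real J * \<mu>)) \<le> 2 powr \<mu> * 2 powr (\<mu> / \<beta>) * real D powr (- (\<mu> / \<beta>))"
    proof -
      have "log 2 (real D / 2) = log 2 (real D) - 1" using D by (simp add: log_divide)
      then have "(log 2 (real D) - 1) / \<beta> * \<mu> \<le> (real J + 1) * \<mu>"
        using J(2) \<mu> by (intro mult_right_mono) auto
      then have "- (real J * \<mu>) \<le> \<mu> + \<mu> / \<beta> + log 2 (real D) * (- (\<mu> / \<beta>))"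
        by (simp add: algebra_simps diff_divide_distrib)
      then have "2 powr (- (real J * \<mu>)) \<le> 2 powr (\<mu> + \<mu> / \<beta> + log 2 (real D) * (- (\<mu> / \<beta>)))"
        by (intro powr_mono) auto
      also have "\<dots> = 2 powr \<mu> * 2 powr (\<mu> / \<beta>) * (2 powr log 2 (real D)) powr (- (\<mu> / \<beta>))"
        by (simp only: powr_add powr_powr)
      also have "2 powr log 2 (real D) = real D" using D by simp
      finally show ?thesis .
    qed
    have "\<forall>k. \<exists>P. P \<in> piecewise_polys (dyadic_rectangles_of (L k)) r \<and>
        (\<integral>\<^sup>+ x. ennreal (\<bar>s x - P x\<bar> powr p) \<partial>cube_measure)
          \<le> ennreal ((2 * R * 2 powr (- (real k * \<mu>))) powr p)"
      using smoothness_class_near_best[OF s assms(2) R p'] unfolding L_def \<mu>_def by blast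
    from choice[OF this] obtain P where P': "\<forall>k. P k \<in> piecewise_polys (dyadic_rectangles_of (L k)) r \<and>
        (\<integral>\<^sup>+ x. ennreal (\<bar>s x - P k x\<bar> powr p) \<partial>cube_measure)
          \<le> ennreal ((2 * R * 2 powr (- (real k * \<mu>))) powr p)"
      by (rule exE)
    have P: "\<forall>k. P k \<in> piecewise_polys (dyadic_rectangles_of (L k)) r"
      and int: "\<And>k. (\<integral>\<^sup>+ x. ennreal (\<bar>s x - P k x\<bar> powr p) \<partial>cube_measure)
          \<le> ennreal ((2 * R * 2 powr (- (real k * \<mu>))) powr p)"
      using P' by simp_all
    define B where "B = 2 * R * 2 powr (- (real J * \<mu>))"
    have B: "0 < B" using R by (simp add: B_def)
    have int': "\<forall>k. (\<integral>\<^sup>+ x. ennreal (\<bar>s x - P (J + k) x\<bar> powr p) \<partial>cube_measure)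
        \<le> ennreal ((B * 2 powr (- (real k * \<mu>))) powr p)"
    proof
      fix k
      have "2 * R * 2 powr (- (real (J + k) * \<mu>)) = B * 2 powr (- (real k * \<mu>))"
        by (simp add: B_def powr_add[symmetric] algebra_simps)
      then show "(\<integral>\<^sup>+ x. ennreal (\<bar>s x - P (J + k) x\<bar> powr p) \<partial>cube_measure)
          \<le> ennreal ((B * 2 powr (- (real k * \<mu>))) powr p)"
        using int[of "J + k"] by simp
    qed
    have "s \<in> borel_measurable cube_measure"
      using s by (simp add: smoothness_class_def Lp_space_def)
    then have "level_approximation r L p \<mu> J B s P"
      using B P int' by (simp add: level_approximation_def)
    then obtain m t where m: "small_dyadic_partition (2 * 2 powr (real J * \<beta>)) m"
      and t: "t \<in> piecewise_polys m r"
      and le: "Lp_norm q (\<lambda>x. s x - t x) \<le> ennreal (c * B)"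
      using approx by blast
    have "m \<in> dyadic_partitions (card m)" 
      using m by (simp add: dyadic_partitions_def small_dyadic_partition_def)
    moreover have "card m \<le> D" using m JD by (simp add: small_dyadic_partition_def)
    ultimately obtain m' where "m' \<in> dyadic_partitions D" "\<forall>K'\<in>m'. \<exists>K\<in>m. K' \<subseteq> K"
      using dyadic_partition_pad by blast
    then have "t \<in> (\<Union>m \<in> dyadic_partitions D. piecewise_polys m r)"
      using piecewise_polys_refine[OF _ t] by blast
    then have "(INF t \<in> (\<Union>m \<in> dyadic_partitions D. piecewise_polys m r). Lp_norm q (\<lambda>x. s x - t x))
        \<le> Lp_norm q (\<lambda>x. s x - t x)"
      by (rule INF_lower)
    also note le
    also have "ennreal (c * B) \<le> ennreal (C * R * real D powr (- (harmonic_mean \<sigma> / real CARD('d))))"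
    proof (rule ennreal_leI)
      have "c * B = c * 2 * R * 2 powr (- (real J * \<mu>))" by (simp add: B_def)
      also have "\<dots> \<le> c * 2 * R * (2 powr \<mu> * 2 powr (\<mu> / \<beta>) * real D powr (- (\<mu> / \<beta>)))"
        using c R by (intro mult_left_mono rate) auto
      finally show "c * B \<le> C * R * real D powr (- (harmonic_mean \<sigma> / real CARD('d)))"
        unfolding H C_def by (simp only: mult_ac)
    qed
    finally show "(INF t \<in> (\<Union>m \<in> dyadic_partitions D. piecewise_polys m r). Lp_norm q (\<lambda>x. s x - t x))
        \<le> ennreal (C * R * real D powr (- (harmonic_mean \<sigma> / real CARD('d))))" .
  qed
qed simp

end
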